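(* Let $\mathcal{G}=(V,\mathcal{E})$ be a (finite, simple) graph. Then $\mathcal{G}$ is join-irreducible if and only if $\check{\mathcal{G}}$ is isomorphic to one of the following graphs: (i) a disjoint union of $n$ copies of $K_3$, for some $n\ge 2$; (ii) $C_5$; (iii) $K_2+\overline{K}_m$, for some $m\geq 2$; (iv) $K_n$, for some $n\ge2$; (v) $\overline{K}_n+\overline{K}_m$, for some $n,m$ with $1\le n<m$; (vi) a graph join $\overline{K}_n+\cdots+\overline{K}_n$ of $r$ copies of $\overline{K}_n$, for some $r,n\ge2$.
   Context: A graph is a pair $\mathcal{G}=(V,\mathcal{E})$ with $V$ a finite nonempty set and $\mathcal{E}\subseteq[V]^2$ (two-element subsets of $V$). $\check{\mathcal{G}}$ denotes the graph obtained from $\mathcal{G}$ by removing its isolated vertices (those in no edge). $K_n$ is the complete graph on $n$ vertices, $\overline{K}_n$ its complement (the edgeless graph on $n$ vertices), $C_n$ the cycle on $n$ vertices. The graph join $\mathcal{G}_1+\mathcal{G}_2$ is the disjoint union of $\mathcal{G}_1$ and $\mathcal{G}_2$ together with all edges $\{i_1,i_2\}$, $i_1\in V_1$, $i_2\in V_2$; iterated joins are defined accordingly. Join-irreducible graph: a Boolean function is a map $f:\{0,1\}^n\to\{0,1\}$, $n\ge1$; $\Omega$ is the set of all of them. For $g$ of arity $m$ and $f$ of arity $n$, $g\le f$ ($g$ is a simple minor of $f$) if there is $\sigma:\{1,\dots,n\}\to\{1,\dots,m\}$ with $g(x_1,\dots,x_m)=f(x_{\sigma(1)},\dots,x_{\sigma(n)})$;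 $g<f$ means $g\le f$ and not $f\le g$. $f$ is irreducible if there is $f'\in\Omega$ with $f'<f$ such that every $g\in\Omega$ with $g<f$ satisfies $g\le f'$ (equivalently, the class of $f$ has a unique lower cover in the poset of equivalence classes of Boolean functions under simple minors). To a graph $\mathcal{G}=(V,\mathcal{E})$ (with $V$ identified with $\{1,\dots,n\}$) associate the $n$-ary Boolean function $f_{\mathcal{G}}$ given by evaluating over $GF(2)$ the polynomial $\sum_{\{i,j\}\in\mathcal{E}}x_ix_j$. $\mathcal{G}$ is join-irreducible if $f_{\mathcal{G}}$ is irreducible. *)

theory Defs
  imports "HOL-Library.FuncSet" "HOL-Library.Ramsey" "HOL-Library.Z2"
begin

section \<open>Graphs\<close>

type_synonym 'a graph = "'a set \<times> 'a set set"

abbreviation verts :: "'a graph \<Rightarrow> 'a set" where "verts G \<equiv> fst G"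
abbreviation edges :: "'a graph \<Rightarrow> 'a set set" where "edges G \<equiv> snd G"

definition is_graph :: "'a graph \<Rightarrow> bool" where
  "is_graph G \<longleftrightarrow> finite (verts G) \<and> verts G \<noteq> {} \<and> edges G \<subseteq> [verts G]\<^bsup>2\<^esup>"

definition graph_iso :: "'a graph \<Rightarrow> 'b graph \<Rightarrow> bool" where
  "graph_iso G H \<longleftrightarrow>
     (\<exists>\<phi>. bij_betw \<phi> (verts G) (verts H) \<and> (\<lambda>e. \<phi> ` e) ` edges G = edges H)"

text \<open>The result has no vertices if the graph has no edges; such a pair is isomorphic
  to no graph in the sense of \<^const>\<open>is_graph\<close>.\<close>

definition remove_isolated :: "'a graph \<Rightarrow> 'a graph" where
  "remove_isolated G = (verts G - {v. \<forall>e\<in>edges G. v \<notin> e}, edges G)"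

definition complete_graph :: "nat \<Rightarrow> nat graph" where
  "complete_graph n = ({..<n}, [{..<n}]\<^bsup>2\<^esup>)"

definition edgeless_graph :: "nat \<Rightarrow> nat graph" where
  "edgeless_graph n = ({..<n}, {})"

text \<open>This is the cycle only for \<open>n \<ge> 3\<close>.\<close>

definition cycle_graph :: "nat \<Rightarrow> nat graph" where
  "cycle_graph n = ({..<n}, {{i, Suc i mod n} | i. i < n})"

definition graph_join :: "'a graph \<Rightarrow> 'b graph \<Rightarrow> ('a + 'b) graph" where
  "graph_join G H =
     (verts G <+> verts H,
      (\<lambda>e. Inl ` e) ` edges G \<union> (\<lambda>e. Inr ` e) ` edges H
        \<union> {{Inl u, Inr v} | u v. u \<in> verts G \<and> v \<in> verts H})"

definition disjoint_copies :: "nat \<Rightarrow> 'a graph \<Rightarrow> (nat \<times> 'a) graph" where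
  "disjoint_copies r G =
     ({..<r} \<times> verts G, {Pair i ` e | i e. i < r \<and> e \<in> edges G})"

text \<open>Iterating \<^const>\<open>graph_join\<close> changes the vertex type in every step, so the
  join of \<open>r\<close> copies is defined in one go; \<open>join_copies_Suc\<close> below relates the two.\<close>

definition join_copies :: "nat \<Rightarrow> 'a graph \<Rightarrow> (nat \<times> 'a) graph" where
  "join_copies r G =
     (verts (disjoint_copies r G),
      edges (disjoint_copies r G)
        \<union> {{(i, u), (j, v)} | i j u v.
              i < r \<and> j < r \<and> i \<noteq> j \<and> u \<in> verts G \<and> v \<in> verts G})"

lemma join_copies_1: "graph_iso (join_copies 1 G) G"
  unfolding graph_iso_def
proof (intro exI conjI)
  show "bij_betw snd (verts (join_copies 1 G)) (verts G)"
    by (auto simp: join_copies_def disjoint_copies_def bij_betw_def inj_on_def image_iff)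
  have "edges (join_copies 1 G) = (\<lambda>e. Pair 0 ` e) ` edges G"
    by (auto simp: join_copies_def disjoint_copies_def)
  then show "(\<lambda>e. snd ` e) ` edges (join_copies 1 G) = edges G"
    by (simp add: image_image)
qed

lemma join_copies_Suc:
  "graph_iso (graph_join (join_copies r G) G) (join_copies (Suc r) G)"
proof -
  let ?\<phi> = "case_sum id (Pair r)"
  let ?C = "{{(i, u), (j, v)} | i j u v.
               i < r \<and> j < r \<and> i \<noteq> j \<and> u \<in> verts G \<and> v \<in> verts G}"
  let ?D = "{{(i, u), (r, v)} | i u v. i < r \<and> u \<in> verts G \<and> v \<in> verts G}"
  have vs: "bij_betw ?\<phi> (verts (graph_join (join_copies r G) G)) (verts (join_copies (Suc r) G))"
  proof -
    have "inj_on ?\<phi> (({..<r} \<times> verts G) <+> verts G)"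
      by (auto simp: inj_on_def)
    moreover have "?\<phi> ` (({..<r} \<times> verts G) <+> verts G) = {..<Suc r} \<times> verts G"
      by (auto simp: Plus_def image_Un image_image less_Suc_eq)
    ultimately show ?thesis
      by (simp add: bij_betw_def graph_join_def join_copies_def disjoint_copies_def)
  qed
  have split: "edges (disjoint_copies (Suc r) G)
      = edges (disjoint_copies r G) \<union> (\<lambda>e. Pair r ` e) ` edges G"
    by (auto simp: disjoint_copies_def less_Suc_eq)
  have cross: "{{(i, u), (j, v)} | i j u v.
               i < Suc r \<and> j < Suc r \<and> i \<noteq> j \<and> u \<in> verts G \<and> v \<in> verts G} = ?C \<union> ?D"
    (is "?L = _")
  proof
    show "?L \<subseteq> ?C \<union> ?D"
    proof
      fix e assume "e \<in> ?L"
      then obtain i j u v where *: "e = {(i, u), (j, v)}" "i < Suc r" "j < Suc r" "i \<noteq> j"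
        "u \<in> verts G" "v \<in> verts G" by blast
      then consider "i < r" "j < r" | "i < r" "j = r" | "i = r" "j < r" by linarith
      then show "e \<in> ?C \<union> ?D"
      proof cases
        case 3
        with * have "e = {(j, v), (r, u)}" by auto
        with 3 * show ?thesis by blast
      qed (use * in blast)+
    qed
    show "?C \<union> ?D \<subseteq> ?L" by (force intro: less_SucI)
  qed
  have im: "(\<lambda>e. ?\<phi> ` e) ` {{Inl u, Inr v} | u v. u \<in> {..<r} \<times> verts G \<and> v \<in> verts G} = ?D"
    (is "?f ` ?A = _")
  proof
    show "?f ` ?A \<subseteq> ?D" by force
    show "?D \<subseteq> ?f ` ?A"
    proof
      fix e assume "e \<in> ?D"
      then obtain i u v where *: "e = {(i, u), (r, v)}" "i < r" "u \<in> verts G" "v \<in> verts G"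
        by blast
      then have "e = ?f {Inl (i, u), Inr v}" "{Inl (i, u), Inr v} \<in> ?A" by auto
      then show "e \<in> ?f ` ?A" by blast
    qed
  qed
  have "verts (join_copies r G) = {..<r} \<times> verts G"
    by (simp add: join_copies_def disjoint_copies_def)
  then have "(\<lambda>e. ?\<phi> ` e) ` edges (graph_join (join_copies r G) G)
      = edges (join_copies r G) \<union> (\<lambda>e. Pair r ` e) ` edges G \<union> ?D"
    using im by (simp add: graph_join_def image_Un image_image)
  also have "\<dots> = edges (join_copies (Suc r) G)"
    using split cross by (auto simp: join_copies_def)
  finally show ?thesis unfolding graph_iso_def using vs by blast
qed


section \<open>Boolean functions and simple minors\<close>

text \<open>A Boolean function is a pair of an arity \<open>n\<close> and a function that is fixed to
  \<^const>\<open>undefined\<close> outside \<open>{0,1}\<close> to the power \<open>n\<close>, so that equality of pairs is equality of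
  Boolean functions. The two-element set is the field \<^typ>\<open>bit\<close>, that is, GF(2).\<close>

type_synonym boolfun = "nat \<times> ((nat \<Rightarrow> bit) \<Rightarrow> bit)"

definition cube :: "nat \<Rightarrow> (nat \<Rightarrow> bit) set" where
  "cube n = {1..n} \<rightarrow>\<^sub>E UNIV"

definition boolfuns :: "boolfun set" where
  "boolfuns = {(n, f). 1 \<le> n \<and> f \<in> cube n \<rightarrow>\<^sub>E UNIV}"

definition minor :: "boolfun \<Rightarrow> boolfun \<Rightarrow> bool" where
  "minor = (\<lambda>(m, g) (n, f).
     \<exists>\<sigma> \<in> {1..n} \<rightarrow> {1..m}. \<forall>x \<in> cube m. g x = f (\<lambda>i\<in>{1..n}. x (\<sigma> i)))"

definition strict_minor :: "boolfun \<Rightarrow> boolfun \<Rightarrow> bool" where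
  "strict_minor g f \<longleftrightarrow> minor g f \<and> \<not> minor f g"

definition irreducible_boolfun :: "boolfun \<Rightarrow> bool" where
  "irreducible_boolfun f \<longleftrightarrow>
     f \<in> boolfuns \<and>
     (\<exists>f'\<in>boolfuns. strict_minor f' f \<and> (\<forall>g\<in>boolfuns. strict_minor g f \<longrightarrow> minor g f'))"


section \<open>Join-irreducible graphs\<close>

text \<open>The function of \<open>G\<close>, where \<open>\<phi>\<close> identifies the vertex set with \<open>{1..n}\<close>.\<close>

definition graph_boolfun :: "('a \<Rightarrow> nat) \<Rightarrow> 'a graph \<Rightarrow> boolfun" where
  "graph_boolfun \<phi> G =
     (card (verts G), \<lambda>x\<in>cube (card (verts G)). \<Sum>e\<in>edges G. \<Prod>v\<in>e. x (\<phi> v))"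

text \<open>The choice of the identification is irrelevant, see \<open>join_irreducible_iff\<close>.\<close>

definition join_irreducible :: "'a graph \<Rightarrow> bool" where
  "join_irreducible G \<longleftrightarrow>
     (\<exists>\<phi>. bij_betw \<phi> (verts G) {1..card (verts G)} \<and> irreducible_boolfun (graph_boolfun \<phi> G))"

lemma minor_trans:
  assumes "minor h g" "minor g f"
  shows "minor h f"
proof -
  obtain k h' m g' n f' where [simp]: "h = (k, h')" "g = (m, g')" "f = (n, f')"
    by (metis surj_pair)
  obtain \<sigma> where s: "\<sigma> \<in> {1..m} \<rightarrow> {1..k}"
    "\<And>x. x \<in> cube k \<Longrightarrow> h' x = g' (\<lambda>i\<in>{1..m}. x (\<sigma> i))"
    using assms(1) by (auto simp: minor_def)
  obtain \<tau> where t: "\<tau> \<in> {1..n} \<rightarrow> {1..m}"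
    "\<And>x. x \<in> cube m \<Longrightarrow> g' x = f' (\<lambda>i\<in>{1..n}. x (\<tau> i))"
    using assms(2) by (auto simp: minor_def)
  have "\<sigma> \<circ> \<tau> \<in> {1..n} \<rightarrow> {1..k}" using s(1) t(1) by auto
  moreover have "h' x = f' (\<lambda>i\<in>{1..n}. x ((\<sigma> \<circ> \<tau>) i))" if "x \<in> cube k" for x
  proof -
    have "(\<lambda>i\<in>{1..m}. x (\<sigma> i)) \<in> cube m" by (simp add: cube_def)
    moreover have "(\<lambda>i\<in>{1..n}. (\<lambda>i\<in>{1..m}. x (\<sigma> i)) (\<tau> i)) = (\<lambda>i\<in>{1..n}. x ((\<sigma> \<circ> \<tau>) i))"
      using t(1) by (intro restrict_ext) (simp add: Pi_iff)
    ultimately show ?thesis using s(2)[OF that] t(2) by metis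
  qed
  ultimately have "\<exists>\<rho> \<in> {1..n} \<rightarrow> {1..k}. \<forall>x \<in> cube k. h' x = f' (\<lambda>i\<in>{1..n}. x (\<rho> i))"
    by (intro bexI[of _ "\<sigma> \<circ> \<tau>"] ballI)
  then show ?thesis by (simp add: minor_def)
qed

lemma graph_boolfun_minor:
  assumes G: "is_graph G"
    and \<phi>: "bij_betw \<phi> (verts G) {1..card (verts G)}"
    and \<psi>: "bij_betw \<psi> (verts G) {1..card (verts G)}"
  shows "minor (graph_boolfun \<phi> G) (graph_boolfun \<psi> G)"
proof -
  let ?n = "card (verts G)"
  let ?\<sigma> = "\<phi> \<circ> the_inv_into (verts G) \<psi>"
  have inv: "bij_betw (the_inv_into (verts G) \<psi>) {1..?n} (verts G)"
    using \<psi> by (rule bij_betw_the_inv_into)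
  have s: "?\<sigma> \<in> {1..?n} \<rightarrow> {1..?n}"
    using bij_betw_trans[OF inv \<phi>] by (auto simp: bij_betw_def)
  have *: "?\<sigma> (\<psi> v) = \<phi> v" "\<psi> v \<in> {1..?n}" if "v \<in> verts G" for v
    using that \<psi> by (auto simp: bij_betw_def the_inv_into_f_f)
  have "(\<Sum>e\<in>edges G. \<Prod>v\<in>e. x (\<phi> v))
      = (\<Sum>e\<in>edges G. \<Prod>v\<in>e. (\<lambda>i\<in>{1..?n}. x (?\<sigma> i)) (\<psi> v))" for x :: "nat \<Rightarrow> bit"
  proof (intro sum.cong prod.cong refl)
    fix e v assume "e \<in> edges G" "v \<in> e"
    then have "v \<in> verts G" using G by (auto simp: is_graph_def nsets_def)
    then show "x (\<phi> v) = (\<lambda>i\<in>{1..?n}. x (?\<sigma> i)) (\<psi> v)"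
      using *[of v] by simp
  qed
  moreover have "(\<lambda>i\<in>{1..?n}. x (?\<sigma> i)) \<in> cube ?n" for x by (simp add: cube_def)
  ultimately have eq: "snd (graph_boolfun \<phi> G) x
      = snd (graph_boolfun \<psi> G) (\<lambda>i\<in>{1..?n}. x (?\<sigma> i))" if "x \<in> cube ?n" for x
    unfolding graph_boolfun_def snd_conv
    using that by (simp only: restrict_apply' simp_thms)
  have "\<exists>\<rho> \<in> {1..?n} \<rightarrow> {1..?n}. \<forall>x \<in> cube ?n. snd (graph_boolfun \<phi> G) x
      = snd (graph_boolfun \<psi> G) (\<lambda>i\<in>{1..?n}. x (\<rho> i))"
    by (rule bexI[OF _ s], rule ballI, rule eq)
  then show ?thesis by (simp add: minor_def graph_boolfun_def)
qed

lemma graph_boolfun_in_boolfuns: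
  assumes "is_graph G"
  shows "graph_boolfun \<phi> G \<in> boolfuns"
  using assms by (auto simp: is_graph_def boolfuns_def graph_boolfun_def Suc_le_eq card_gt_0_iff)

lemma join_irreducible_iff:
  assumes G: "is_graph G"
    and \<phi>: "bij_betw \<phi> (verts G) {1..card (verts G)}"
  shows "join_irreducible G \<longleftrightarrow> irreducible_boolfun (graph_boolfun \<phi> G)"
proof
  assume "join_irreducible G"
  then obtain \<psi> where \<psi>: "bij_betw \<psi> (verts G) {1..card (verts G)}"
    and irr: "irreducible_boolfun (graph_boolfun \<psi> G)"
    by (auto simp: join_irreducible_def)
  have "strict_minor g (graph_boolfun \<phi> G) \<longleftrightarrow> strict_minor g (graph_boolfun \<psi> G)" for g
    unfolding strict_minor_def
    using minor_trans graph_boolfun_minor[OF G \<phi> \<psi>] graph_boolfun_minor[OF G \<psi> \<phi>] by blast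
  with irr show "irreducible_boolfun (graph_boolfun \<phi> G)"
    by (simp add: irreducible_boolfun_def graph_boolfun_in_boolfuns[OF G])
qed (use \<phi> in \<open>auto simp: join_irreducible_def\<close>)

end

theory Submission
  imports Defs
begin

text \<open>Every proper minor of \<open>f\<^sub>G\<close> lies below a merge \<open>f\<^sub>i\<^sub>j\<close>, obtained by identifying two essential
  variables, so \<open>f\<^sub>G\<close> is irreducible iff some \<open>f\<^sub>i\<^sub>j\<close> lies above all merges. Merging a pair \<open>k, l\<close>
  loses a second variable iff \<open>k\<close> and \<open>l\<close> have the same neighbours or \<open>{k, l}\<close> is the neighbourhood
  of some vertex; call such pairs lossy. If \<open>k, l\<close> is not lossy and \<open>f\<^sub>k\<^sub>l\<close> lies below \<open>f\<^sub>i\<^sub>j\<close>, then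
  comparing the numbers of variables shows that the two are equivalent. As merging an edge creates
  a linear term and merging a non-edge does not, all edges are lossy if \<open>{i, j}\<close> is not an edge, and
  all non-edges are lossy if it is one. In the first case every component is a triangle. In the second
  case either all non-adjacent vertices have the same neighbours, so that the graph is complete
  multipartite, or a chase through vertices of degree two closes up to a 5-cycle. In a complete
  multipartite graph the number of quadratic terms containing the linear variable recovers the sum of
  the sizes of the two parts joined by a non-lossy edge, so that all parts have the same size unless
  there are only two parts or there is a lossy edge. Conversely, all non-lossy pairs of the listed
  graphs are equivalent under automorphisms, and a merge that loses a further variable \<open>u\<close> lies below
  each merge of \<open>u\<close> with another vertex.\<close>

section \<open>Substitution of variables\<close>

text \<open>A Boolean function is encoded as a predicate on the set of the variables with value 1, so that
  substituting variables becomes taking preimages.\<close>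

definition subst_le :: "('b set \<Rightarrow> bool) \<Rightarrow> ('a set \<Rightarrow> bool) \<Rightarrow> bool" (infix "\<sqsubseteq>" 50) where
  "H \<sqsubseteq> F \<longleftrightarrow> (\<exists>\<rho>. \<forall>S. H S = F (\<rho> -` S))"

definition ess :: "('a set \<Rightarrow> bool) \<Rightarrow> 'a set" where
  "ess F = {v. \<exists>S. F (insert v S) \<noteq> F (S - {v})}"

text \<open>A support is carried along beside \<open>ess\<close> because the variable type may be
  infinite: there \<open>\<lambda>S. infinite S\<close> has no essential variable and yet is not
  constant.\<close>

definition depends_on :: "('a set \<Rightarrow> bool) \<Rightarrow> 'a set \<Rightarrow> bool" where
  "depends_on F V \<longleftrightarrow> (\<forall>S T. S \<inter> V = T \<inter> V \<longrightarrow> F S = F T)"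

text \<open>The variable \<open>j\<close> is replaced by \<open>i\<close>, so \<open>i\<close>
  survives. Up to equivalence the order does not matter, see \<open>merge_commute\<close>.\<close>

definition merge :: "('a set \<Rightarrow> bool) \<Rightarrow> 'a \<Rightarrow> 'a \<Rightarrow> 'a set \<Rightarrow> bool" where
  "merge F i j S = F (id(j := i) -` S)"

definition greatest_merge :: "('a set \<Rightarrow> bool) \<Rightarrow> bool" where
  "greatest_merge F \<longleftrightarrow> (\<exists>i\<in>ess F. \<exists>j\<in>ess F. i \<noteq> j \<and>
     (\<forall>k\<in>ess F. \<forall>l\<in>ess F. k \<noteq> l \<longrightarrow> merge F k l \<sqsubseteq> merge F i j))"

lemma subst_leI: "(\<And>S. H S = F (\<rho> -` S)) \<Longrightarrow> H \<sqsubseteq> F"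
  by (auto simp: subst_le_def)

lemma subst_le_trans:
  assumes "K \<sqsubseteq> H" "H \<sqsubseteq> F"
  shows "K \<sqsubseteq> F"
proof -
  obtain \<rho> \<sigma> where "\<And>S. K S = H (\<rho> -` S)" "\<And>S. H S = F (\<sigma> -` S)"
    using assms by (auto simp: subst_le_def)
  then have "K S = F ((\<rho> \<circ> \<sigma>) -` S)" for S by (simp add: vimage_comp)
  then show ?thesis by (rule subst_leI)
qed

lemma depends_onD: "depends_on F V \<Longrightarrow> (\<And>v. v \<in> V \<Longrightarrow> v \<in> S \<longleftrightarrow> v \<in> T) \<Longrightarrow> F S = F T"
  unfolding depends_on_def by blast

lemma ess_iff: "v \<in> ess F \<longleftrightarrow> (\<exists>S. F (insert v S) \<noteq> F (S - {v}))"
  by (simp add: ess_def)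

lemma ess_subset: "depends_on F V \<Longrightarrow> ess F \<subseteq> V"
proof
  fix v assume F: "depends_on F V" and "v \<in> ess F"
  then obtain S where S: "F (insert v S) \<noteq> F (S - {v})" by (auto simp: ess_iff)
  show "v \<in> V"
  proof (rule ccontr)
    assume "v \<notin> V"
    then have "F (insert v S) = F (S - {v})" by (intro depends_onD[OF F]) auto
    with S show False by simp
  qed
qed

lemma depends_on_remove:
  assumes "depends_on F V" "v \<notin> ess F"
  shows "depends_on F (V - {v})"
  unfolding depends_on_def
proof (intro allI impI)
  fix S T assume "S \<inter> (V - {v}) = T \<inter> (V - {v})"
  then have "F (S - {v}) = F (T - {v})" by (intro depends_onD[OF assms(1)]) auto
  moreover have "F R = F (R - {v})" for R
    using assms(2) unfolding ess_iff by (metis insert_absorb Diff_empty Diff_insert0)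
  ultimately show "F S = F T" by metis
qed

text \<open>Inessential variables are discarded one at a time, which is why the support
  \<open>V\<close> is assumed finite.\<close>

lemma depends_on_ess:
  assumes "finite V" "depends_on F V"
  shows "depends_on F (ess F)"
proof -
  have "depends_on F (V - D)" if "finite D" "D \<inter> ess F = {}" for D
    using that
  proof (induction D)
    case empty then show ?case using assms by simp
  next
    case (insert v D)
    then have "depends_on F (V - D - {v})" by (intro depends_on_remove) auto
    then show ?case by (subst Diff_insert)
  qed
  from this[of "V - ess F"] assms(1) have "depends_on F (V - (V - ess F))" by auto
  moreover have "V - (V - ess F) = ess F" using ess_subset[OF assms(2)] by auto
  ultimately show ?thesis by simp
qed

lemma ess_vimage_subset:
  assumes F: "depends_on F (ess F)" and H: "\<And>S. H S = F (\<rho> -` S)"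
  shows "ess H \<subseteq> \<rho> ` ess F"
proof -
  have "depends_on H (\<rho> ` ess F)"
    unfolding depends_on_def H by (auto intro!: depends_onD[OF F])
  then show ?thesis by (rule ess_subset)
qed

section \<open>Merging two variables\<close>

lemma merge_le: "merge F i j \<sqsubseteq> F"
  by (rule subst_leI[of _ _ "id(j := i)"]) (simp add: merge_def)

text \<open>A substitution identifying \<open>i\<close> and \<open>j\<close> does not change if
  \<open>j\<close> is first sent to \<open>i\<close>, so it factors through the merge.\<close>

lemma le_mergeI:
  assumes "\<And>S. H S = F (\<rho> -` S)" "\<rho> i = \<rho> j"
  shows "H \<sqsubseteq> merge F i j"
proof (rule subst_leI)
  fix S
  have "\<rho> \<circ> id(j := i) = \<rho>" using assms(2) by auto
  then show "H S = merge F i j (\<rho> -` S)"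
    by (simp add: merge_def assms(1) vimage_comp)
qed

lemma merge_commute: "merge F i j \<sqsubseteq> merge F j i"
  by (rule le_mergeI[of _ _ "id(j := i)"]) (simp_all add: merge_def)

lemma merge_eq: "merge F i j S = F (if i \<in> S then insert j S else S - {j})"
  unfolding merge_def by (rule arg_cong[of _ _ F]) (auto split: if_splits)

lemma depends_on_merge:
  assumes "depends_on F (ess F)" "i \<in> ess F"
  shows "depends_on (merge F i j) (ess F - {j} \<union> {i})"
  unfolding depends_on_def merge_def
  using assms(2) by (auto intro!: depends_onD[OF assms(1)] split: if_splits)

text \<open>A merge depends on fewer variables than \<open>F\<close>, and by
  \<open>ess_vimage_subset\<close> a substitution cannot increase the number of essential
  variables.\<close>

lemma not_le_merge:
  assumes F: "depends_on F (ess F)" "finite (ess F)" and ij: "i \<in> ess F" "j \<in> ess F" "i \<noteq> j"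
  shows "\<not> F \<sqsubseteq> merge F i j"
proof
  assume "F \<sqsubseteq> merge F i j"
  then obtain \<rho> where "\<And>S. F S = F ((\<rho> \<circ> id(j := i)) -` S)"
    by (auto simp: subst_le_def merge_def vimage_comp)
  then have "ess F \<subseteq> (\<rho> \<circ> id(j := i)) ` ess F" by (rule ess_vimage_subset[OF F(1)])
  also have "\<dots> \<subseteq> \<rho> ` (ess F - {j})" using ij by auto
  finally have "card (ess F) \<le> card (ess F - {j})"
    using F(2) by (meson surj_card_le finite_Diff)
  moreover have "card (ess F - {j}) < card (ess F)"
    using ij(2) F(2) by (rule card_Diff1_less[rotated])
  ultimately show False by simp
qed

text \<open>A substitution injective on \<open>ess F\<close> can be undone; hence one leading
  strictly below \<open>F\<close> identifies two essential variables.\<close>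

lemma le_some_merge:
  assumes F: "depends_on F (ess F)" and "H \<sqsubseteq> F" "\<not> F \<sqsubseteq> H"
  obtains i j where "i \<in> ess F" "j \<in> ess F" "i \<noteq> j" "H \<sqsubseteq> merge F i j"
proof -
  obtain \<rho> where H: "\<And>S. H S = F (\<rho> -` S)" using assms(2) by (auto simp: subst_le_def)
  have "\<not> inj_on \<rho> (ess F)"
  proof
    assume inj: "inj_on \<rho> (ess F)"
    have "F S = H (inv_into (ess F) \<rho> -` S)" for S
      unfolding H using inj by (intro depends_onD[OF F]) auto
    then have "F \<sqsubseteq> H" by (rule subst_leI)
    with assms(3) show False by simp
  qed
  then show ?thesis using that le_mergeI[of H F, OF H] by (auto simp: inj_on_def)
qed


section \<open>Simple minors as substitutions\<close>

text \<open>A set stands for its indicator vector. Elements outside \<open>{1..fst f}\<close> have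
  no influence, so the arity survives only as a support.\<close>

definition on_sets :: "boolfun \<Rightarrow> nat set \<Rightarrow> bool" where
  "on_sets f S \<longleftrightarrow> snd f (\<lambda>i\<in>{1..fst f}. of_bool (i \<in> S)) = 1"

lemma depends_on_on_sets: "depends_on (on_sets f) {1..fst f}"
proof -
  have "(\<lambda>i\<in>{1..fst f}. of_bool (i \<in> S)) = (\<lambda>i\<in>{1..fst f}. of_bool (i \<in> T) :: bit)"
    if "S \<inter> {1..fst f} = T \<inter> {1..fst f}" for S T
    using that by (intro restrict_ext arg_cong[of _ _ of_bool]) blast
  then show ?thesis unfolding depends_on_def on_sets_def by metis
qed

lemma cube_eq_of_bool:
  assumes "x \<in> cube n"
  shows "x = (\<lambda>i\<in>{1..n}. of_bool (i \<in> {i. x i = 1}))"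
proof
  fix i show "x i = (\<lambda>i\<in>{1..n}. of_bool (i \<in> {i. x i = 1})) i"
    using assms by (cases "i \<in> {1..n}"; cases "x i = 1") (simp_all add: cube_def PiE_arb[of x] del: atLeastAtMost_iff)
qed

lemma bit_eq_one_iff: "a = b \<longleftrightarrow> (a = 1 \<longleftrightarrow> b = 1)" for a b :: bit
  by (cases a; cases b) auto

lemma minor_iff:
  assumes "fst g \<ge> 1"
  shows "minor g f \<longleftrightarrow> on_sets g \<sqsubseteq> on_sets f"
proof -
  obtain m g' n f' where [simp]: "g = (m, g')" "f = (n, f')" by (metis surj_pair)
  show ?thesis
  proof
    assume "minor g f"
    then obtain \<sigma> where s: "\<sigma> \<in> {1..n} \<rightarrow> {1..m}"
      "\<And>x. x \<in> cube m \<Longrightarrow> g' x = f' (\<lambda>i\<in>{1..n}. x (\<sigma> i))"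
      by (auto simp: minor_def)
    have "on_sets g S = on_sets f (\<sigma> -` S)" for S
    proof -
      have "(\<lambda>i\<in>{1..n}. (\<lambda>i\<in>{1..m}. of_bool (i \<in> S)) (\<sigma> i))
          = (\<lambda>i\<in>{1..n}. of_bool (i \<in> \<sigma> -` S) :: bit)"
        using s(1) by (intro restrict_ext) (simp add: Pi_iff)
      then show ?thesis
        using s(2)[of "\<lambda>i\<in>{1..m}. of_bool (i \<in> S)"] by (simp add: on_sets_def cube_def)
    qed
    then show "on_sets g \<sqsubseteq> on_sets f" by (rule subst_leI)
  next
    assume "on_sets g \<sqsubseteq> on_sets f"
    then obtain \<rho> where r: "\<And>S. on_sets g S = on_sets f (\<rho> -` S)" by (auto simp: subst_le_def)
    \<comment> \<open>\<open>\<rho>\<close> may leave \<open>{1..m}\<close>. Such values are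
      redirected to 1, which is in range since the arity is positive, and \<open>on_sets g\<close>
      does not notice the change.\<close>
    define \<pi> where "\<pi> i = (if i \<in> {1..m} then i else 1)" for i
    have "\<pi> \<circ> \<rho> \<in> {1..n} \<rightarrow> {1..m}" using assms by (auto simp: \<pi>_def)
    moreover have "g' x = f' (\<lambda>i\<in>{1..n}. x ((\<pi> \<circ> \<rho>) i))" if "x \<in> cube m" for x
    proof -
      let ?S = "{i. x i = 1}"
      have "g' x = 1 \<longleftrightarrow> on_sets g ?S"
        using cube_eq_of_bool[OF that] by (simp add: on_sets_def)
      also have "\<dots> = on_sets g (\<pi> -` ?S)"
        by (rule depends_onD[OF depends_on_on_sets]) (simp add: \<pi>_def)
      also have "\<dots> = on_sets f ((\<pi> \<circ> \<rho>) -` ?S)" by (simp only: r vimage_comp)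
      also have "(\<lambda>i\<in>{1..n}. of_bool (i \<in> (\<pi> \<circ> \<rho>) -` ?S)) = (\<lambda>i\<in>{1..n}. x ((\<pi> \<circ> \<rho>) i))"
        by (intro restrict_ext) (subst bit_eq_one_iff, simp)
      then have "on_sets f ((\<pi> \<circ> \<rho>) -` ?S) \<longleftrightarrow> f' (\<lambda>i\<in>{1..n}. x ((\<pi> \<circ> \<rho>) i)) = 1"
        by (simp add: on_sets_def)
      finally show ?thesis by (subst bit_eq_one_iff)
    qed
    ultimately have "\<exists>\<tau> \<in> {1..n} \<rightarrow> {1..m}. \<forall>x \<in> cube m. g' x = f' (\<lambda>i\<in>{1..n}. x (\<tau> i))"
      by (intro bexI[of _ "\<pi> \<circ> \<rho>"] ballI)
    then show "minor g f" by (simp add: minor_def)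
  qed
qed

lemma boolfun_exists:
  assumes "finite V" "depends_on F V"
  obtains f where "f \<in> boolfuns" "on_sets f \<sqsubseteq> F" "F \<sqsubseteq> on_sets f"
proof -
  \<comment> \<open>Boolean functions have positive arity, so a dummy variable is added to cover an
    empty \<open>V\<close>.\<close>
  define n where "n = Suc (card V)"
  obtain \<beta> where b: "bij_betw \<beta> V {1..card V}"
    using assms(1) by (metis finite_same_card_bij finite_atLeastAtMost card_atLeastAtMost diff_Suc_1)
  define f where "f = (n, \<lambda>x\<in>cube n. of_bool (F {v. x (\<beta> v) = 1}) :: bit)"
  have n: "\<beta> v \<in> {1..n}" if "v \<in> V" for v
    using bij_betwE[OF b] that by (auto simp: n_def le_Suc_eq)
  have *: "on_sets f S = F (\<beta> -` S)" for S
  proof -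
    have "(\<lambda>i\<in>{1..n}. of_bool (i \<in> S)) \<in> cube n" by (simp add: cube_def)
    then have "on_sets f S = F {v. (\<lambda>i\<in>{1..n}. of_bool (i \<in> S) :: bit) (\<beta> v) = 1}"
      unfolding on_sets_def f_def fst_conv snd_conv by (simp only: restrict_apply') simp
    also have "\<dots> = F (\<beta> -` S)" using n by (intro depends_onD[OF assms(2)]) auto
    finally show ?thesis .
  qed
  show ?thesis
  proof
    show "f \<in> boolfuns" by (auto simp: boolfuns_def f_def n_def)
    show "on_sets f \<sqsubseteq> F" using * by (rule subst_leI)
    have "F S = on_sets f (inv_into V \<beta> -` S)" for S
      unfolding * using b by (intro depends_onD[OF assms(2)]) (auto simp: bij_betw_def)
    then show "F \<sqsubseteq> on_sets f" by (rule subst_leI)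
  qed
qed

text \<open>By \<open>le_some_merge\<close> the merges bound all strict minors, and each merge is
  itself equivalent to a strict minor. The variables of \<open>F\<close> may differ from those of
  \<open>f\<close>, which later allows vertices as variables.\<close>

lemma irreducible_boolfun_iff:
  assumes f: "f \<in> boolfuns" "on_sets f \<sqsubseteq> F" "F \<sqsubseteq> on_sets f"
    and F: "depends_on F (ess F)" "finite (ess F)"
  shows "irreducible_boolfun f \<longleftrightarrow> greatest_merge F"
proof -
  have mi: "minor g h \<longleftrightarrow> on_sets g \<sqsubseteq> on_sets h" if "g \<in> boolfuns" for g h
    using that by (intro minor_iff) (auto simp: boolfuns_def)
  have strict: "strict_minor g f \<longleftrightarrow> on_sets g \<sqsubseteq> F \<and> \<not> F \<sqsubseteq> on_sets g" if "g \<in> boolfuns" for g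
  proof -
    have "on_sets g \<sqsubseteq> on_sets f \<longleftrightarrow> on_sets g \<sqsubseteq> F"
      using f(2,3) by (meson subst_le_trans)
    moreover have "on_sets f \<sqsubseteq> on_sets g \<longleftrightarrow> F \<sqsubseteq> on_sets g"
      using f(2,3) by (meson subst_le_trans)
    ultimately show ?thesis unfolding strict_minor_def mi[OF that] mi[OF f(1)] by simp
  qed
  have enc: "\<exists>g\<in>boolfuns. on_sets g \<sqsubseteq> merge F i j \<and> merge F i j \<sqsubseteq> on_sets g \<and> strict_minor g f"
    if ij: "i \<in> ess F" "j \<in> ess F" "i \<noteq> j" for i j
  proof -
    obtain g where g: "g \<in> boolfuns" "on_sets g \<sqsubseteq> merge F i j" "merge F i j \<sqsubseteq> on_sets g"
      by (rule boolfun_exists[OF _ depends_on_merge[OF F(1) ij(1), of j]]) (use F(2) in auto)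
    moreover have "strict_minor g f"
      using strict[OF g(1)] subst_le_trans[OF g(2) merge_le] subst_le_trans[OF _ g(2)]
        not_le_merge[OF F ij] by blast
    ultimately show ?thesis by blast
  qed
  show ?thesis
  proof
    assume "irreducible_boolfun f"
    then obtain f' where f': "f' \<in> boolfuns" "strict_minor f' f"
      "\<And>g. g \<in> boolfuns \<Longrightarrow> strict_minor g f \<Longrightarrow> on_sets g \<sqsubseteq> on_sets f'"
      by (auto simp: irreducible_boolfun_def mi)
    \<comment> \<open>The bound \<open>f'\<close> is itself a strict minor, hence below some merge,
      which therefore lies above all merges.\<close>
    obtain i j where ij: "i \<in> ess F" "j \<in> ess F" "i \<noteq> j" "on_sets f' \<sqsubseteq> merge F i j"
      using le_some_merge[OF F(1)] strict[OF f'(1)] f'(2) by metis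
    have "merge F k l \<sqsubseteq> merge F i j" if "k \<in> ess F" "l \<in> ess F" "k \<noteq> l" for k l
      using enc[OF that] f'(3) ij(4) by (meson subst_le_trans)
    with ij show "greatest_merge F" unfolding greatest_merge_def by blast
  next
    assume "greatest_merge F"
    then obtain i j where ij: "i \<in> ess F" "j \<in> ess F" "i \<noteq> j"
      "\<And>k l. k \<in> ess F \<Longrightarrow> l \<in> ess F \<Longrightarrow> k \<noteq> l \<Longrightarrow> merge F k l \<sqsubseteq> merge F i j"
      unfolding greatest_merge_def by blast
    obtain f' where f': "f' \<in> boolfuns" "merge F i j \<sqsubseteq> on_sets f'" "strict_minor f' f"
      using enc[OF ij(1-3)] by blast
    have "minor g f'" if g: "g \<in> boolfuns" "strict_minor g f" for g
    proof -
      obtain k l where "k \<in> ess F" "l \<in> ess F" "k \<noteq> l" "on_sets g \<sqsubseteq> merge F k l"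
        using le_some_merge[OF F(1)] strict[OF g(1)] g(2) by metis
      then show ?thesis unfolding mi[OF g(1)] using ij(4) f'(2) by (meson subst_le_trans)
    qed
    with f' f(1) show "irreducible_boolfun f" unfolding irreducible_boolfun_def by blast
  qed
qed


text \<open>As \<open>u\<close> does not matter after merging \<open>k\<close> and \<open>l\<close>,
  it may be replaced by \<open>w\<close> as well; the combined substitution identifies
  \<open>u\<close> with \<open>w\<close>.\<close>

lemma merge_le_inessential:
  assumes "u \<notin> ess (merge F k l)" "u \<noteq> l" "w \<noteq> u" "w \<noteq> l"
  shows "merge F k l \<sqsubseteq> merge F u w"
proof (rule le_mergeI)
  fix S
  have "merge F k l S = merge F k l (S - {u})" "merge F k l (insert u S) = merge F k l (S - {u})"
    using assms(1) unfolding ess_iff by (metis insert_absorb Diff_empty Diff_insert0)+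
  then have "merge F k l S = merge F k l (id(u := w) -` S)"
  proof -
    have "id(u := w) -` S = (if w \<in> S then insert u S else S - {u})"
      by (auto split: if_splits)
    then show ?thesis
      using \<open>merge F k l S = _\<close> \<open>merge F k l (insert u S) = _\<close> by simp
  qed
  then show "merge F k l S = F ((id(u := w) \<circ> id(l := k)) -` S)"
    by (simp add: merge_def vimage_comp)
next
  show "(id(u := w) \<circ> id(l := k)) u = (id(u := w) \<circ> id(l := k)) w"
    using assms by auto
qed

lemma merge_le_automorphism:
  assumes "\<And>S. F (\<pi> -` S) = F S"
  shows "merge F (\<pi> i) (\<pi> j) \<sqsubseteq> merge F i j"
proof (rule le_mergeI)
  show "merge F (\<pi> i) (\<pi> j) S = F ((id(\<pi> j := \<pi> i) \<circ> \<pi>) -` S)" for S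
    unfolding merge_def vimage_comp[symmetric] assms ..
qed simp

text \<open>If \<open>H\<close> has at least as many essential variables as \<open>M\<close>, the
  substitution can neither drop nor identify any. \<open>H\<close> and \<open>M\<close> can then be
  compared set by set, which the invariants of merges exploit.\<close>

lemma substitution_bij:
  assumes M: "depends_on M (ess M)" "finite (ess M)" and "H \<sqsubseteq> M" "card (ess M) \<le> card (ess H)"
  obtains \<rho> where "bij_betw \<rho> (ess M) (ess H)" "\<And>T. T \<subseteq> ess M \<Longrightarrow> H (\<rho> ` T) = M T"
proof -
  obtain \<rho> where r: "\<And>S. H S = M (\<rho> -` S)" using assms(3) by (auto simp: subst_le_def)
  have sub: "ess H \<subseteq> \<rho> ` ess M" by (rule ess_vimage_subset[OF M(1) r])
  have c: "card (\<rho> ` ess M) \<le> card (ess M)" "card (ess H) \<le> card (\<rho> ` ess M)"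
    using M(2) sub by (auto intro: card_image_le card_mono)
  have inj: "inj_on \<rho> (ess M)" using c assms(4) M(2) by (intro eq_card_imp_inj_on) auto
  have "ess H = \<rho> ` ess M" using c assms(4) M(2) sub by (intro card_subset_eq) auto
  with inj have "bij_betw \<rho> (ess M) (ess H)" by (simp add: bij_betw_def)
  moreover have "H (\<rho> ` T) = M T" if "T \<subseteq> ess M" for T
    unfolding r using that inj by (intro depends_onD[OF M(1)]) (auto simp: inj_on_def)
  ultimately show ?thesis using that by blast
qed


section \<open>Parity of the number of edges\<close>

text \<open>The value of the graph polynomial at the indicator vector of \<open>S\<close>: a
  monomial contributes 1 exactly when its edge lies in \<open>S\<close>.\<close>

definition edge_parity :: "'a set set \<Rightarrow> 'a set \<Rightarrow> bool" where
  "edge_parity E S \<longleftrightarrow> odd (card {e \<in> E. e \<subseteq> S})"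

lemma edge_parity_image:
  assumes "inj_on \<phi> (\<Union>E)"
  shows "edge_parity ((\<lambda>e. \<phi> ` e) ` E) S = edge_parity E (\<phi> -` S)"
proof -
  have "{e \<in> (\<lambda>e. \<phi> ` e) ` E. e \<subseteq> S} = (\<lambda>e. \<phi> ` e) ` {e \<in> E. e \<subseteq> \<phi> -` S}" by auto
  moreover have "inj_on (\<lambda>e. \<phi> ` e) {e \<in> E. e \<subseteq> \<phi> -` S}"
  proof (rule inj_onI)
    fix d e assume "d \<in> {e \<in> E. e \<subseteq> \<phi> -` S}" "e \<in> {e \<in> E. e \<subseteq> \<phi> -` S}" "\<phi> ` d = \<phi> ` e"
    then show "d = e" using inj_on_image_eq_iff[OF assms, of d e] by blast
  qed
  ultimately show ?thesis by (simp add: edge_parity_def card_image)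
qed

text \<open>Only edges are recorded. The vertices are those covered by edges, in agreement with
  \<open>remove_isolated\<close> and, by \<open>ess_par\<close>, with the essential
  variables.\<close>

locale edge_set =
  fixes E :: "'a set set"
  assumes finite_edges: "finite E" and card_edge: "e \<in> E \<Longrightarrow> card e = 2"
begin

abbreviation "V \<equiv> \<Union>E"
abbreviation "par \<equiv> edge_parity E"

definition nbr :: "'a \<Rightarrow> 'a set" where
  "nbr v = {u. {u, v} \<in> E}"

text \<open>For distinct \<open>i\<close> and \<open>j\<close>, the first alternative makes
  \<open>i\<close> inessential after the merge and the second makes \<open>u\<close> inessential. By
  \<open>ess_merge_not_lossy\<close> a second variable is lost in no other way.\<close>

definition lossy :: "'a \<Rightarrow> 'a \<Rightarrow> bool" where
  "lossy i j \<longleftrightarrow> nbr i = nbr j \<or> (\<exists>u. nbr u = {i, j})"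

lemma finite_V: "finite V"
  using finite_edges card_edge by (metis card.infinite finite_Union zero_neq_numeral)

lemma edge_eq: "e \<in> E \<Longrightarrow> v \<in> e \<Longrightarrow> \<exists>u. u \<noteq> v \<and> e = {u, v}"
  using card_edge[of e] by (auto simp: card_2_iff)

lemma not_nbr_self [simp]: "v \<notin> nbr v"
  using card_edge[of "{v}"] by (auto simp: nbr_def)

lemma nbr_sym: "u \<in> nbr v \<longleftrightarrow> v \<in> nbr u"
  by (simp add: nbr_def insert_commute)

lemma nbr_subset: "nbr v \<subseteq> V"
  by (auto simp: nbr_def)

lemma nbr_in_V: "u \<in> nbr v \<Longrightarrow> u \<in> V" "u \<in> nbr v \<Longrightarrow> v \<in> V"
  by (auto simp: nbr_def)

lemma finite_nbr: "finite (nbr v)"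
  using finite_V nbr_subset by (rule finite_subset[rotated])

lemma in_V_iff: "v \<in> V \<longleftrightarrow> nbr v \<noteq> {}"
proof
  assume "v \<in> V"
  then obtain e where "e \<in> E" "v \<in> e" by blast
  with edge_eq[of e v] show "nbr v \<noteq> {}" by (auto simp: nbr_def)
qed (use nbr_in_V in blast)

text \<open>The derivative of the quadratic polynomial with respect to \<open>v\<close> is the sum
  of the variables in \<open>nbr v\<close>.\<close>

lemma par_insert:
  assumes "v \<notin> S"
  shows "par (insert v S) \<longleftrightarrow> par S \<noteq> odd (card (nbr v \<inter> S))"
proof -
  have "{e \<in> E. e \<subseteq> insert v S} = {e \<in> E. e \<subseteq> S} \<union> (\<lambda>u. {u, v}) ` (nbr v \<inter> S)"
  proof
    show "{e \<in> E. e \<subseteq> insert v S} \<subseteq> {e \<in> E. e \<subseteq> S} \<union> (\<lambda>u. {u, v}) ` (nbr v \<inter> S)"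
    proof
      fix e assume "e \<in> {e \<in> E. e \<subseteq> insert v S}"
      then show "e \<in> {e \<in> E. e \<subseteq> S} \<union> (\<lambda>u. {u, v}) ` (nbr v \<inter> S)"
        using edge_eq[of e v] by (cases "v \<in> e") (auto simp: nbr_def)
    qed
  qed (auto simp: nbr_def)
  moreover have "{e \<in> E. e \<subseteq> S} \<inter> (\<lambda>u. {u, v}) ` (nbr v \<inter> S) = {}"
    using assms by auto
  moreover have "inj_on (\<lambda>u. {u, v}) (nbr v \<inter> S)"
    by (auto simp: inj_on_def doubleton_eq_iff)
  ultimately show ?thesis
    using finite_edges finite_nbr[of v] by (simp add: edge_parity_def card_Un_disjoint card_image)
qed

lemma par_small [simp]: "\<not> par {}" "\<not> par {v}"
proof -
  have "{e \<in> E. e \<subseteq> {}} = {}" using card_edge[of "{}"] by auto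
  then show *: "\<not> par {}" unfolding edge_parity_def by (simp only: card.empty even_zero not_not)
  show "\<not> par {v}" using par_insert[of v "{}"] * by simp
qed

lemma par_pair: "i \<noteq> j \<Longrightarrow> par {i, j} \<longleftrightarrow> i \<in> nbr j"
  using par_insert[of i "{j}"] nbr_sym[of i j] by (cases "j \<in> nbr i") simp_all

lemma par_triple:
  assumes "i \<noteq> j" "v \<noteq> i" "v \<noteq> j"
  shows "par {v, i, j} \<longleftrightarrow> (i \<in> nbr j) \<noteq> ((v \<in> nbr i) \<noteq> (v \<in> nbr j))"
  using par_insert[of v "{i, j}"] par_pair[OF assms(1)] assms nbr_sym[of v i] nbr_sym[of v j]
  by (cases "i \<in> nbr v"; cases "j \<in> nbr v") (simp_all add: Int_insert_right)

lemma depends_on_par: "depends_on par V"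
proof -
  have "{e \<in> E. e \<subseteq> S} = {e \<in> E. e \<subseteq> T}" if "S \<inter> V = T \<inter> V" for S T
    using that by blast
  then show ?thesis unfolding depends_on_def edge_parity_def by metis
qed

lemma ess_par [simp]: "ess par = V"
proof
  show "V \<subseteq> ess par"
  proof
    fix v assume "v \<in> V"
    then obtain u where "u \<in> nbr v" using in_V_iff by blast
    moreover from this have "u \<noteq> v" by auto
    ultimately have "par (insert v {u})" "\<not> par ({u} - {v})"
      using par_pair[of v u] nbr_sym[of v u] by simp_all
    then show "v \<in> ess par" unfolding ess_iff by blast
  qed
qed (rule ess_subset[OF depends_on_par])

text \<open>In the merged polynomial x_i occurs linearly iff \<open>{i, j}\<close> is an edge,
  because x_i x_i = x_i, and x_i x_v occurs iff \<open>v\<close> is adjacent to exactly one of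
  \<open>i\<close> and \<open>j\<close>, because equal terms cancel. Singletons and pairs detect
  this.\<close>

lemma merge_pair:
  assumes "i \<noteq> j"
  shows "merge par i j {v} \<longleftrightarrow> v = i \<and> i \<in> nbr j"
    and "v \<noteq> i \<Longrightarrow> v \<noteq> j \<Longrightarrow>
      merge par i j {i, v} \<longleftrightarrow> (i \<in> nbr j) \<noteq> ((v \<in> nbr i) \<noteq> (v \<in> nbr j))"
proof -
  show "merge par i j {v} \<longleftrightarrow> v = i \<and> i \<in> nbr j"
    using assms par_pair[OF assms] by (cases "v = j") (auto simp: merge_eq insert_commute)
  assume "v \<noteq> i" "v \<noteq> j"
  moreover have "insert j {i, v} = {v, i, j}" by auto
  ultimately show "merge par i j {i, v} \<longleftrightarrow> (i \<in> nbr j) \<noteq> ((v \<in> nbr i) \<noteq> (v \<in> nbr j))"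
    using par_triple[OF assms, of v] by (simp add: merge_eq)
qed

section \<open>Essential variables of a merge\<close>

lemma ess_merge_subset:
  assumes "i \<in> V" "i \<noteq> j"
  shows "ess (merge par i j) \<subseteq> V - {j}"
proof -
  have "depends_on par (ess par)" by (simp add: depends_on_par)
  from ess_subset[OF depends_on_merge[OF this]] assms show ?thesis by auto
qed

lemma merge_finitary:
  assumes "i \<in> V" "i \<noteq> j"
  shows "finite (ess (merge par i j))" "depends_on (merge par i j) (ess (merge par i j))"
proof -
  show "finite (ess (merge par i j))"
    using ess_merge_subset[OF assms] finite_V by (meson finite_subset finite_Diff)
  have "depends_on (merge par i j) (V - {j} \<union> {i})"
    using depends_on_merge[of par i j] depends_on_par assms by simp
  then show "depends_on (merge par i j) (ess (merge par i j))"
    using finite_V by (intro depends_on_ess) auto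
qed

text \<open>The derivative with respect to \<open>v\<close> is evaluated at preimages under
  \<open>id(j := i)\<close>, which are the sets containing both or neither of \<open>i\<close> and
  \<open>j\<close>.\<close>

lemma ess_merge_iff:
  assumes "i \<noteq> j" "v \<noteq> i" "v \<noteq> j"
  shows "v \<in> ess (merge par i j) \<longleftrightarrow>
    (\<exists>T. v \<notin> T \<and> (i \<in> T \<longleftrightarrow> j \<in> T) \<and> odd (card (nbr v \<inter> T)))"
proof -
  have *: "merge par i j (insert v S) \<noteq> merge par i j (S - {v}) \<longleftrightarrow>
      odd (card (nbr v \<inter> (id(j := i) -` S - {v})))" for S
  proof -
    have "id(j := i) -` insert v S = insert v (id(j := i) -` S - {v})"
      "id(j := i) -` (S - {v}) = id(j := i) -` S - {v}"
      using assms by (auto split: if_splits)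
    then show ?thesis
      using par_insert[of v "id(j := i) -` S - {v}"] unfolding merge_def by auto
  qed
  show ?thesis
  proof
    assume "v \<in> ess (merge par i j)"
    then obtain S where "odd (card (nbr v \<inter> (id(j := i) -` S - {v})))"
      unfolding ess_iff * by blast
    then show "\<exists>T. v \<notin> T \<and> (i \<in> T \<longleftrightarrow> j \<in> T) \<and> odd (card (nbr v \<inter> T))"
      using assms by (intro exI[of _ "id(j := i) -` S - {v}"]) auto
  next
    assume "\<exists>T. v \<notin> T \<and> (i \<in> T \<longleftrightarrow> j \<in> T) \<and> odd (card (nbr v \<inter> T))"
    then obtain T where T: "v \<notin> T" "i \<in> T \<longleftrightarrow> j \<in> T" "odd (card (nbr v \<inter> T))" by blast
    then have "id(j := i) -` T - {v} = T" by (auto split: if_splits)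
    with T(3) * show "v \<in> ess (merge par i j)" unfolding ess_iff by metis
  qed
qed

text \<open>Toggling the merged variable toggles \<open>i\<close> and \<open>j\<close> together. The
  parity changes by the possible edge between them plus the edges from each of them into
  \<open>T\<close>.\<close>

lemma ess_merge_first_iff:
  assumes "i \<noteq> j"
  shows "i \<in> ess (merge par i j) \<longleftrightarrow>
    (\<exists>T. i \<notin> T \<and> j \<notin> T \<and> ((i \<in> nbr j) \<noteq> (odd (card (nbr i \<inter> T)) \<noteq> odd (card (nbr j \<inter> T)))))"
proof -
  have *: "merge par i j (insert i S) \<noteq> merge par i j (S - {i}) \<longleftrightarrow>
      (i \<in> nbr j) \<noteq> (odd (card (nbr i \<inter> (S - {i, j}))) \<noteq> odd (card (nbr j \<inter> (S - {i, j}))))" for S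
  proof -
    let ?T = "S - {i, j}"
    have 1: "insert j (insert i S) = insert i (insert j ?T)" and 2: "S - {i} - {j} = ?T" by auto
    have 3: "nbr i \<inter> insert j ?T = (if j \<in> nbr i then insert j (nbr i \<inter> ?T) else nbr i \<inter> ?T)"
      by auto
    have "par (insert i (insert j ?T)) \<longleftrightarrow>
        (par ?T \<noteq> odd (card (nbr j \<inter> ?T))) \<noteq> odd (card (nbr i \<inter> insert j ?T))"
      using par_insert[of j ?T] par_insert[of i "insert j ?T"] assms by auto
    also have "odd (card (nbr i \<inter> insert j ?T)) \<longleftrightarrow> (i \<in> nbr j) \<noteq> odd (card (nbr i \<inter> ?T))"
      using nbr_sym[of i j] finite_nbr[of i] unfolding 3 by (cases "j \<in> nbr i") simp_all
    finally show ?thesis using 1 2 by (auto simp: merge_eq)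
  qed
  show ?thesis
  proof
    assume "i \<in> ess (merge par i j)"
    then obtain S where "merge par i j (insert i S) \<noteq> merge par i j (S - {i})"
      unfolding ess_iff by blast
    then show "\<exists>T. i \<notin> T \<and> j \<notin> T \<and>
        ((i \<in> nbr j) \<noteq> (odd (card (nbr i \<inter> T)) \<noteq> odd (card (nbr j \<inter> T))))"
      unfolding * by (intro exI[of _ "S - {i, j}"]) auto
  next
    assume "\<exists>T. i \<notin> T \<and> j \<notin> T \<and>
        ((i \<in> nbr j) \<noteq> (odd (card (nbr i \<inter> T)) \<noteq> odd (card (nbr j \<inter> T))))"
    then obtain T where T: "i \<notin> T" "j \<notin> T"
        "(i \<in> nbr j) \<noteq> (odd (card (nbr i \<inter> T)) \<noteq> odd (card (nbr j \<inter> T)))" by blast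
    then have "T - {i, j} = T" by auto
    with T(3) show "i \<in> ess (merge par i j)" unfolding ess_iff * by metis
  qed
qed

text \<open>The derivative with respect to \<open>u\<close> is x_i + x_j, which vanishes once the
  two variables are identified.\<close>

lemma inessential_if_nbr_eq_pair:
  assumes "i \<noteq> j" "nbr u = {i, j}"
  shows "u \<notin> ess (merge par i j)"
proof -
  have "u \<noteq> i" "u \<noteq> j" using assms(2) not_nbr_self[of u] by auto
  moreover have "even (card ({i, j} \<inter> T))" if "i \<in> T \<longleftrightarrow> j \<in> T" for T
    using that assms(1) by (cases "i \<in> T") simp_all
  ultimately show ?thesis using assms by (auto simp: ess_merge_iff)
qed

text \<open>Twins are not adjacent, and their edges cancel in pairs.\<close>

lemma inessential_if_twins:
  assumes "i \<noteq> j" "nbr i = nbr j"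
  shows "i \<notin> ess (merge par i j)"
  using assms not_nbr_self[of i] by (auto simp: ess_merge_first_iff)

lemma ess_merge_not_lossy:
  assumes "i \<in> V" "i \<noteq> j" "\<not> lossy i j"
  shows "ess (merge par i j) = V - {j}"
proof
  show "V - {j} \<subseteq> ess (merge par i j)"
  proof
    fix v assume v: "v \<in> V - {j}"
    show "v \<in> ess (merge par i j)"
    proof (cases "v = i")
      case True
      have "\<exists>T. i \<notin> T \<and> j \<notin> T \<and>
        ((i \<in> nbr j) \<noteq> (odd (card (nbr i \<inter> T)) \<noteq> odd (card (nbr j \<inter> T))))"
      proof (cases "i \<in> nbr j")
        \<comment> \<open>The linear term coming from the edge is visible at the empty set.\<close>
        case True then show ?thesis by (intro exI[of _ "{}"]) simp
      next
        case False
        \<comment> \<open>Without an edge, the witness is a vertex telling the two neighbourhoods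
          apart.\<close>
        obtain w where w: "w \<in> nbr i \<longleftrightarrow> w \<notin> nbr j" using assms(3) by (auto simp: lossy_def)
        then have "w \<noteq> i" "w \<noteq> j" using False nbr_sym[of i j] by auto
        then show ?thesis
          using w False by (intro exI[of _ "{w}"]) (cases "w \<in> nbr i"; simp)
      qed
      then show ?thesis unfolding True ess_merge_first_iff[OF assms(2)] .
    next
      case False
      have "\<exists>T. v \<notin> T \<and> (i \<in> T \<longleftrightarrow> j \<in> T) \<and> odd (card (nbr v \<inter> T))"
      proof (cases "nbr v \<subseteq> {i, j}")
        case True
        have "nbr v \<noteq> {}" "nbr v \<noteq> {i, j}"
          using v in_V_iff assms(3) unfolding lossy_def by blast+
        \<comment> \<open>As \<open>v\<close> is not isolated and the pair is not lossy, exactly one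
          of \<open>i\<close> and \<open>j\<close> is adjacent to \<open>v\<close>; so
          \<open>{i, j}\<close>, which contains both, meets \<open>nbr v\<close> in one
          point.\<close>
        with True have "nbr v = {i} \<or> nbr v = {j}" by blast
        then have "card (nbr v \<inter> {i, j}) = 1" by (elim disjE) simp_all
        moreover have "v \<notin> {i, j}" using v False by blast
        ultimately show ?thesis by (intro exI[of _ "{i, j}"]) simp
      next
        case nsub: False
        then obtain w where w: "w \<in> nbr v" "w \<noteq> i" "w \<noteq> j" by blast
        then have "v \<noteq> w" using not_nbr_self[of v] by blast
        with w show ?thesis by (intro exI[of _ "{w}"]) simp
      qed
      then show ?thesis using ess_merge_iff[OF assms(2) False] v by simp
    qed
  qed
qed (rule ess_merge_subset[OF assms(1,2)])

section \<open>Merges above a non-lossy merge\<close>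

lemma not_lossy_substitution:
  assumes ij: "i \<in> V" "j \<in> V" "i \<noteq> j" and kl: "k \<in> V" "l \<in> V" "k \<noteq> l"
    and "\<not> lossy k l" and le: "merge par k l \<sqsubseteq> merge par i j"
  obtains \<rho> where "bij_betw \<rho> (ess (merge par i j)) (V - {l})"
    "\<And>T. T \<subseteq> ess (merge par i j) \<Longrightarrow> merge par k l (\<rho> ` T) = merge par i j T"
proof -
  have e: "ess (merge par k l) = V - {l}" using ess_merge_not_lossy assms by blast
  \<comment> \<open>The merge of \<open>k, l\<close> keeps all variables but \<open>l\<close>, and
    that of \<open>i, j\<close> has at most as many, so the substitution must be bijective.\<close>
  have "card (ess (merge par i j)) \<le> card (V - {j})"
    using ess_merge_subset[OF ij(1,3)] finite_V by (intro card_mono) auto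
  also have "\<dots> = card (V - {l})" using ij kl by (simp add: card_Diff_singleton)
  finally have "card (ess (merge par i j)) \<le> card (ess (merge par k l))" by (simp add: e)
  from substitution_bij[OF merge_finitary(2,1)[OF ij(1,3)] le this] that e show ?thesis by metis
qed

text \<open>The bijection preserves the values at singletons, and a singleton of value 1 exists only
  in the merge of an edge.\<close>

lemma not_lossy_edge_iff:
  assumes ij: "i \<in> V" "j \<in> V" "i \<noteq> j" and kl: "k \<in> V" "l \<in> V" "k \<noteq> l"
    and "\<not> lossy k l" and le: "merge par k l \<sqsubseteq> merge par i j"
  shows "k \<in> nbr l \<longleftrightarrow> i \<in> nbr j"
proof -
  obtain \<rho> where r: "bij_betw \<rho> (ess (merge par i j)) (V - {l})"
    "\<And>T. T \<subseteq> ess (merge par i j) \<Longrightarrow> merge par k l (\<rho> ` T) = merge par i j T"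
    using not_lossy_substitution assms by metis
  show ?thesis
  proof
    assume "k \<in> nbr l"
    obtain t where t: "t \<in> ess (merge par i j)" "k = \<rho> t"
      using r(1) kl by (auto simp: bij_betw_def)
    have "merge par k l {k}" using \<open>k \<in> nbr l\<close> merge_pair(1)[OF kl(3)] by blast
    then have "merge par i j {t}" using r(2)[of "{t}"] t by simp
    then show "i \<in> nbr j" using merge_pair(1)[OF ij(3)] by blast
  next
    assume "i \<in> nbr j"
    then have i: "merge par i j {i}" using merge_pair(1)[OF ij(3)] by blast
    have "\<not> merge par i j {}" by (simp add: merge_def)
    with i have "i \<in> ess (merge par i j)" unfolding ess_iff by (intro exI[of _ "{}"]) simp
    with i r(2)[of "{i}"] have "merge par k l {\<rho> i}" by simp
    then show "k \<in> nbr l" using merge_pair(1)[OF kl(3)] by blast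
  qed
qed

text \<open>Merging an edge \<open>{i, j}\<close> produces the linear term \<open>x\<^sub>i\<close>, hence a distinguished variable;
  the cardinality below counts its quadratic terms.\<close>

lemma card_sym_diff_not_lossy:
  assumes ij: "i \<in> V" "j \<in> V" "i \<in> nbr j" and kl: "k \<in> V" "l \<in> V" "k \<in> nbr l"
    and "\<not> lossy k l" and le: "merge par k l \<sqsubseteq> merge par i j"
  shows "card (sym_diff (nbr k) (nbr l) - {k, l})
    = card {v \<in> ess (merge par i j). v \<noteq> i \<and> \<not> merge par i j {i, v}}"
proof -
  let ?M = "merge par i j" and ?H = "merge par k l"
  have ne: "i \<noteq> j" "k \<noteq> l" using ij(3) kl(3) by auto
  obtain \<rho> where r: "bij_betw \<rho> (ess ?M) (V - {l})"
    "\<And>T. T \<subseteq> ess ?M \<Longrightarrow> ?H (\<rho> ` T) = ?M T"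
    using not_lossy_substitution ij(1,2) kl(1,2) ne assms(7,8) by metis
  have i: "?M {i}" using ij(3) merge_pair(1)[OF ne(1)] by blast
  have "\<not> ?M {}" by (simp add: merge_def)
  with i have ie: "i \<in> ess ?M" unfolding ess_iff by (intro exI[of _ "{}"]) simp
  with i r(2)[of "{i}"] have "?H {\<rho> i}" by simp
  \<comment> \<open>The only linear terms are those of \<open>i\<close> and \<open>k\<close>, so the
    bijection matches them.\<close>
  then have ri: "\<rho> i = k" using merge_pair(1)[OF ne(2)] by blast
  have inj: "inj_on \<rho> (ess ?M)" and im: "\<rho> ` ess ?M = V - {l}" using r(1) by (auto simp: bij_betw_def)
  have Hv: "?H {k, \<rho> v} = ?M {i, v}" if "v \<in> ess ?M" for v
    using r(2)[of "{i, v}"] that ie ri by simp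
  \<comment> \<open>The linear term contributes 1 at \<open>{i, v}\<close>, so a false value signals
    the presence of the quadratic term.\<close>
  have "\<rho> ` {v \<in> ess ?M. v \<noteq> i \<and> \<not> ?M {i, v}} = {v \<in> \<rho> ` ess ?M. v \<noteq> k \<and> \<not> ?H {k, v}}"
    using Hv ri ie inj by (auto simp: inj_on_def)
  also have "\<dots> = {v \<in> V - {l}. v \<noteq> k \<and> (v \<in> nbr k) \<noteq> (v \<in> nbr l)}"
    unfolding im using merge_pair(2)[OF ne(2)] kl(3) by auto
  also have "\<dots> = sym_diff (nbr k) (nbr l) - {k, l}"
    using nbr_in_V(1) by blast
  finally show ?thesis
    using inj card_image[of \<rho> "{v \<in> ess ?M. v \<noteq> i \<and> \<not> ?M {i, v}}"]
    by (simp add: inj_on_def)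
qed


section \<open>Graphs with a greatest merge\<close>

text \<open>Adjacent vertices cannot be twins.\<close>

lemma lossy_edge: "k \<in> nbr l \<Longrightarrow> lossy k l \<Longrightarrow> \<exists>u. nbr u = {k, l}"
  using not_nbr_self[of k] nbr_sym[of k l] by (auto simp: lossy_def)

lemma triangles:
  assumes "\<And>k l. k \<in> nbr l \<Longrightarrow> lossy k l" and "v \<in> V"
  obtains u w where "u \<noteq> v" "w \<noteq> v" "u \<noteq> w" "nbr v = {u, w}" "nbr u = {v, w}" "nbr w = {u, v}"
proof -
  \<comment> \<open>The lossy edge \<open>{u, v}\<close> provides \<open>z\<close> with neighbours
    \<open>u\<close> and \<open>v\<close>; as a neighbour of \<open>u\<close> other than
    \<open>v\<close>, it must be \<open>w\<close>.\<close>
  have third: "nbr w = {u, v}" if "nbr u = {v, w}" for u v w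
  proof -
    have "u \<in> nbr v" using that nbr_sym[of u v] by simp
    then obtain z where z: "nbr z = {u, v}" using lossy_edge assms(1) by blast
    then have "z \<in> nbr u" "z \<noteq> v" using nbr_sym[of u z] not_nbr_self[of z] by auto
    with that z show ?thesis by auto
  qed
  obtain w where w: "w \<in> nbr v" using assms(2) in_V_iff by blast
  then obtain u where u: "nbr u = {v, w}" using lossy_edge[of v w] assms(1) nbr_sym[of v w] by blast
  have "nbr w = {u, v}" using third[OF u] .
  moreover have "nbr v = {u, w}" using third[of u w v] u by (simp add: insert_commute)
  moreover have "u \<notin> {v, w}" using not_nbr_self[of u] unfolding u .
  moreover have "w \<noteq> v" using w not_nbr_self[of v] by blast
  ultimately show ?thesis using that u by blast
qed

lemma five_cycle:
  assumes lossy: "\<And>k l. k \<in> V \<Longrightarrow> l \<in> V \<Longrightarrow> k \<notin> nbr l \<Longrightarrow> k \<noteq> l \<Longrightarrow> lossy k l"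
    and ij: "i \<in> V" "j \<in> V" "i \<notin> nbr j" "nbr i \<noteq> nbr j"
  obtains a b c d e where "distinct [a, b, c, d, e]" "V = {a, b, c, d, e}"
    "nbr a = {b, e}" "nbr b = {a, c}" "nbr c = {b, d}" "nbr d = {c, e}" "nbr e = {d, a}"
proof -
  \<comment> \<open>After exchanging \<open>i\<close> and \<open>j\<close> if necessary, there is a
    path \<open>j, k, i, l\<close> whose ends are not adjacent and whose vertex \<open>k\<close> has
    degree two.\<close>
  have "\<exists>i j k l. i \<in> V \<and> j \<in> V \<and> i \<notin> nbr j \<and> i \<noteq> j \<and> nbr k = {i, j} \<and> l \<in> nbr i \<and> l \<notin> nbr j"
  proof -
    have "i \<noteq> j" using ij(4) by auto
    then obtain k where "nbr k = {i, j}" using lossy[OF ij(1-3)] ij(4) by (auto simp: lossy_def)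
    moreover have "(\<exists>l. l \<in> nbr i \<and> l \<notin> nbr j) \<or> (\<exists>l. l \<in> nbr j \<and> l \<notin> nbr i)" using ij(4) by blast
    moreover have "{i, j} = {j, i}" by blast
    ultimately show ?thesis using ij \<open>i \<noteq> j\<close> nbr_sym[of i j] by metis
  qed
  then obtain i j k l where ij: "i \<in> V" "j \<in> V" "i \<notin> nbr j" "i \<noteq> j" and k: "nbr k = {i, j}"
    and l: "l \<in> nbr i" "l \<notin> nbr j" by blast
  have pair: "\<exists>u. nbr u = {x, y}" if "x \<in> V" "y \<in> V" "x \<notin> nbr y" "nbr x \<noteq> nbr y" for x y
    using lossy[OF that(1-3)] that(4) by (auto simp: lossy_def)
  have kV: "k \<in> V" "l \<in> V" using k l nbr_in_V in_V_iff by blast+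
  have jk: "j \<in> nbr k" "k \<in> nbr j" "i \<in> nbr k" "k \<in> nbr i" using k nbr_sym[of k j] nbr_sym[of k i] by auto
  have lj: "j \<notin> nbr l" "l \<noteq> j" "i \<in> nbr l" "l \<noteq> i"
    using l nbr_sym[of l j] nbr_sym[of l i] ij nbr_sym[of i j] by auto
  have kne: "k \<noteq> i" "k \<noteq> j" "k \<noteq> l" using jk l by auto
  have lk: "l \<notin> nbr k" "k \<notin> nbr l" using k lj nbr_sym[of k l] by auto
  have "nbr k \<noteq> nbr l" using jk lj by auto
  \<comment> \<open>The vertex with neighbourhood \<open>{k, l}\<close> lies in
    \<open>nbr k = {i, j}\<close> and is not \<open>j\<close>, so \<open>i\<close> has degree two as
    well.\<close>
  then obtain m where m: "nbr m = {k, l}" using pair[OF kV lk(2)] by blast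
  then have "m \<in> nbr k" "m \<in> nbr l" using nbr_sym[of m k] nbr_sym[of m l] by auto
  with k lj have mi: "m = i" by auto
  have ni: "nbr i = {k, l}" using m mi by simp
  have "nbr j \<noteq> nbr l" using jk lk by auto
  \<comment> \<open>The fifth vertex, joining the ends of the path.\<close>
  then obtain p where p: "nbr p = {j, l}" using pair[OF ij(2) kV(2) lj(1)] by blast
  have pn: "p \<noteq> i" "p \<noteq> k" "p \<noteq> j" "p \<noteq> l"
    using p ni k ij lj lk jk l by auto
  have pV: "p \<in> V" using p in_V_iff by blast
  have "i \<notin> nbr p" using p lj ij by auto
  moreover have "nbr i \<noteq> nbr p" using p ij nbr_sym[of i j] by auto
  \<comment> \<open>The pairs \<open>i, p\<close> and \<open>k, p\<close> determine the
    neighbourhoods of \<open>l\<close> and \<open>j\<close> in the same way.\<close>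
  ultimately obtain q where q: "nbr q = {i, p}" using pair[OF ij(1) pV] by blast
  then have "q \<in> nbr i" using nbr_sym[of q i] by auto
  then have "q = l" using ni q k pn ij by auto
  then have nl: "nbr l = {i, p}" using q by simp
  have "k \<notin> nbr p" using p kne by simp
  moreover have "nbr k \<noteq> nbr p" using k p ij lj by auto
  ultimately obtain s where s: "nbr s = {k, p}" using pair[OF kV(1) pV] by blast
  then have "s \<in> nbr k" using nbr_sym[of s k] by auto
  then have "s = j" using k ni s pn lj by auto
  then have nj: "nbr j = {k, p}" using s by simp
  have dist: "distinct [i, k, j, p, l]" using ij lj pn kne by auto
  \<comment> \<open>A further vertex \<open>v\<close> would be neither adjacent to \<open>i\<close>
    nor its twin, so some \<open>u\<close> would have neighbourhood \<open>{i, v}\<close>. But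
    \<open>u\<close> would be \<open>k\<close> or \<open>l\<close>, whose neighbours lie on the
    cycle.\<close>
  have "V = {i, k, j, p, l}"
  proof (rule ccontr)
    assume "V \<noteq> {i, k, j, p, l}"
    then obtain v where v: "v \<in> V" "v \<notin> {i, k, j, p, l}" using ij kV pV by auto
    then have "i \<notin> nbr v" using ni nbr_sym[of i v] by auto
    moreover have "nbr i \<noteq> nbr v"
    proof
      assume "nbr i = nbr v"
      then have "v \<in> nbr k" using jk nbr_sym[of k v] by auto
      with k v show False by auto
    qed
    ultimately obtain u where u: "nbr u = {i, v}" using pair[OF ij(1) v(1)] by blast
    then have "u \<in> nbr i" using nbr_sym[of u i] by auto
    with ni u k nl v show False by auto
  qed
  with dist ni k nj p nl show ?thesis
    by (intro that[of i k j p l]) (auto simp: insert_commute)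
qed

text \<open>By \<open>not_lossy_edge_iff\<close>, non-lossy pairs are all edges or all non-edges.
  The non-adjacent pair kept in the first case later ensures at least two triangles.\<close>

lemma greatest_mergeD:
  assumes "greatest_merge par"
  obtains (nonedge) "\<And>k l. k \<in> nbr l \<Longrightarrow> lossy k l"
      and "\<exists>i\<in>V. \<exists>j\<in>V. i \<noteq> j \<and> i \<notin> nbr j"
    | (edge) i j where "i \<in> nbr j"
      "\<And>k l. k \<in> V \<Longrightarrow> l \<in> V \<Longrightarrow> k \<notin> nbr l \<Longrightarrow> k \<noteq> l \<Longrightarrow> lossy k l"
      "\<And>k l. k \<in> V \<Longrightarrow> l \<in> V \<Longrightarrow> k \<noteq> l \<Longrightarrow> merge par k l \<sqsubseteq> merge par i j"
proof -
  obtain i j where ij: "i \<in> V" "j \<in> V" "i \<noteq> j"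
    and le: "\<And>k l. k \<in> V \<Longrightarrow> l \<in> V \<Longrightarrow> k \<noteq> l \<Longrightarrow> merge par k l \<sqsubseteq> merge par i j"
    using assms unfolding greatest_merge_def ess_par by blast
  have iff: "k \<in> nbr l \<longleftrightarrow> i \<in> nbr j" if "k \<in> V" "l \<in> V" "k \<noteq> l" "\<not> lossy k l" for k l
    using not_lossy_edge_iff[OF ij that(1-4) le] that by blast
  show ?thesis
  proof (cases "i \<in> nbr j")
    case True
    then show ?thesis using edge[of i j] iff le by blast
  next
    case False
    have "lossy k l" if "k \<in> nbr l" for k l
      using iff[of k l] False nbr_in_V[OF that] that not_nbr_self[of k] by blast
    then show ?thesis using nonedge False ij by blast
  qed
qed

end


section \<open>Transfer to graphs\<close>

lemma edge_set_graph: "is_graph G \<Longrightarrow> edge_set (edges G)"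
proof
  assume G: "is_graph G"
  then have "edges G \<subseteq> Pow (verts G)" "finite (verts G)" by (auto simp: is_graph_def nsets_def)
  then show "finite (edges G)" by (simp add: finite_subset)
  show "card e = 2" if "e \<in> edges G" for e using G that by (auto simp: is_graph_def nsets_def)
qed

lemma verts_remove_isolated:
  assumes "is_graph G"
  shows "verts (remove_isolated G) = \<Union>(edges G)"
  using assms by (auto simp: remove_isolated_def is_graph_def nsets_def)

lemma on_sets_graph_boolfun:
  assumes G: "is_graph G" and \<phi>: "bij_betw \<phi> (verts G) {1..card (verts G)}"
  shows "on_sets (graph_boolfun \<phi> G) S = edge_parity (edges G) (\<phi> -` S)"
proof -
  let ?n = "card (verts G)"
  let ?x = "\<lambda>i\<in>{1..?n}. of_bool (i \<in> S) :: bit"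
  have x: "?x \<in> cube ?n" by (simp add: cube_def)
  have sub: "e \<subseteq> verts G" "finite e" if "e \<in> edges G" for e
    using G that by (auto simp: is_graph_def nsets_def)
  have "(\<Prod>v\<in>e. ?x (\<phi> v)) = of_bool (e \<subseteq> \<phi> -` S)" if "e \<in> edges G" for e
  proof -
    have "(\<Prod>v\<in>e. ?x (\<phi> v)) = (\<Prod>v\<in>e. of_bool (v \<in> \<phi> -` S))"
    proof (rule prod.cong)
      fix v assume "v \<in> e"
      then have "\<phi> v \<in> {1..?n}" using sub[OF that] bij_betwE[OF \<phi>] by blast
      then show "?x (\<phi> v) = of_bool (v \<in> \<phi> -` S)" by simp
    qed simp
    also have "\<dots> = of_bool (e \<subseteq> \<phi> -` S)"
    proof (cases "e \<subseteq> \<phi> -` S")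
      case True
      then show ?thesis by (simp add: subset_iff)
    next
      case False
      then obtain v where "v \<in> e" "v \<notin> \<phi> -` S" by blast
      then have "(\<Prod>v\<in>e. of_bool (v \<in> \<phi> -` S)) = (0 :: bit)"
        using sub(2)[OF that] by (intro prod_zero) (auto intro!: bexI[of _ v])
      with False show ?thesis by simp
    qed
    finally show ?thesis .
  qed
  then have "snd (graph_boolfun \<phi> G) ?x = (\<Sum>e\<in>edges G. of_bool (e \<subseteq> \<phi> -` S))"
    unfolding graph_boolfun_def snd_conv restrict_apply'[OF x] by (intro sum.cong) simp_all
  also have "\<dots> = of_nat (card {e \<in> edges G. e \<subseteq> \<phi> -` S})"
    using edge_set.finite_edges[OF edge_set_graph[OF G]]
    by (simp add: of_bool_def sum.If_cases Int_def)
  finally have "on_sets (graph_boolfun \<phi> G) S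
      \<longleftrightarrow> of_nat (card {e \<in> edges G. e \<subseteq> \<phi> -` S}) = (1 :: bit)"
    by (simp add: on_sets_def graph_boolfun_def)
  moreover have "of_nat k = (1 :: bit) \<longleftrightarrow> odd k" for k
    by (induction k) auto
  ultimately show ?thesis by (simp add: edge_parity_def)
qed

text \<open>\<open>H\<close> is arbitrary so that both directions are served:
  \<open>H = remove_isolated G\<close> for the analysis of \<open>G\<close>, and a listed graph for
  its verification. The first conclusion supplies the locale for \<open>H\<close>.\<close>

lemma join_irreducible_iff_greatest_merge:
  assumes G: "is_graph G" and iso: "graph_iso (remove_isolated G) H"
  shows "edge_set (edges H)" "\<Union>(edges H) = verts H"
    and "join_irreducible G \<longleftrightarrow> greatest_merge (edge_parity (edges H))"
proof -
  interpret G: edge_set "edges G" using edge_set_graph[OF G] .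
  obtain \<psi> where "bij_betw \<psi> (verts (remove_isolated G)) (verts H)"
    and "(\<lambda>e. \<psi> ` e) ` edges (remove_isolated G) = edges H"
    using iso by (auto simp: graph_iso_def)
  then have \<psi>: "bij_betw \<psi> (\<Union>(edges G)) (verts H)" and E: "edges H = (\<lambda>e. \<psi> ` e) ` edges G"
    by (simp_all only: verts_remove_isolated[OF G]) (simp add: remove_isolated_def)
  have inj: "inj_on \<psi> (\<Union>(edges G))" using \<psi> by (simp add: bij_betw_def)
  show H: "edge_set (edges H)"
  proof
    show "finite (edges H)" by (simp add: E G.finite_edges)
    fix e assume "e \<in> edges H"
    then obtain d where d: "d \<in> edges G" "e = \<psi> ` d" by (auto simp: E)
    then have "inj_on \<psi> d" using inj by (meson Sup_upper inj_on_subset)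
    then show "card e = 2" using d G.card_edge by (simp add: card_image)
  qed
  interpret H: edge_set "edges H" by fact
  have "\<Union>(edges H) = \<psi> ` \<Union>(edges G)" by (auto simp: E)
  then show "\<Union>(edges H) = verts H" using \<psi> by (simp add: bij_betw_def)
  obtain \<phi> where \<phi>: "bij_betw \<phi> (verts G) {1..card (verts G)}"
    using G ex_bij_betw_finite_nat[of "verts G"] unfolding is_graph_def
    by (metis ex_bij_betw_nat_finite_1 bij_betw_inv)
  let ?f = "graph_boolfun \<phi> G"
  have V: "\<Union>(edges G) \<subseteq> verts G" using G by (auto simp: is_graph_def nsets_def)
  have HG: "H.par S = G.par (\<psi> -` S)" for S
    unfolding E by (rule edge_parity_image[OF inj])
  \<comment> \<open>Isolated vertices of \<open>G\<close> have no influence, so the two bijections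
    and their inverses give substitutions both ways.\<close>
  have "H.par \<sqsubseteq> on_sets ?f"
  proof (rule subst_leI)
    fix S
    show "H.par S = on_sets ?f ((\<psi> \<circ> inv_into (verts G) \<phi>) -` S)"
      unfolding HG on_sets_graph_boolfun[OF G \<phi>]
      using V \<phi> by (intro depends_onD[OF G.depends_on_par]) (auto simp: bij_betw_def subset_iff)
  qed
  moreover have "on_sets ?f \<sqsubseteq> H.par"
  proof (rule subst_leI)
    fix S
    show "on_sets ?f S = H.par ((\<phi> \<circ> inv_into (\<Union>(edges G)) \<psi>) -` S)"
      unfolding HG on_sets_graph_boolfun[OF G \<phi>]
      using inj by (intro depends_onD[OF G.depends_on_par]) (auto simp del: Union_iff)
  qed
  moreover have "depends_on H.par (ess H.par)" "finite (ess H.par)"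
    unfolding H.ess_par by (rule H.depends_on_par H.finite_V)+
  ultimately have "irreducible_boolfun ?f \<longleftrightarrow> greatest_merge H.par"
    by (intro irreducible_boolfun_iff graph_boolfun_in_boolfuns[OF G])
  then show "join_irreducible G \<longleftrightarrow> greatest_merge H.par"
    using join_irreducible_iff[OF G \<phi>] by simp
qed

lemma graph_iso_refl: "graph_iso G G"
  unfolding graph_iso_def by (rule exI[of _ id]) simp

lemma graph_isoI:
  assumes G: "is_graph G" and \<phi>: "bij_betw \<phi> (\<Union>(edges G)) (verts H)"
    and adj: "\<And>u v. u \<in> \<Union>(edges G) \<Longrightarrow> v \<in> \<Union>(edges G) \<Longrightarrow>
      {u, v} \<in> edges G \<longleftrightarrow> {\<phi> u, \<phi> v} \<in> edges H"
    and H: "\<And>e. e \<in> edges H \<Longrightarrow> \<exists>x\<in>verts H. \<exists>y\<in>verts H. e = {x, y}"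
  shows "graph_iso (remove_isolated G) H"
proof -
  interpret edge_set "edges G" using edge_set_graph[OF G] .
  have "(\<lambda>e. \<phi> ` e) ` edges G = edges H"
  proof
    show "(\<lambda>e. \<phi> ` e) ` edges G \<subseteq> edges H"
    proof
      fix d assume "d \<in> (\<lambda>e. \<phi> ` e) ` edges G"
      then obtain e where e: "e \<in> edges G" "d = \<phi> ` e" by blast
      then obtain u v where "e = {u, v}" using card_edge[OF e(1)] by (auto simp: card_2_iff)
      with e adj[of u v] show "d \<in> edges H" by auto
    qed
    show "edges H \<subseteq> (\<lambda>e. \<phi> ` e) ` edges G"
    proof
      fix d assume d: "d \<in> edges H"
      then obtain x y where xy: "x \<in> verts H" "y \<in> verts H" "d = {x, y}" using H by blast
      then obtain u v where uv: "u \<in> V" "v \<in> V" "x = \<phi> u" "y = \<phi> v"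
        using \<phi> unfolding bij_betw_def by (metis imageE)
      then have "{u, v} \<in> edges G" using adj xy d by metis
      moreover have "d = \<phi> ` {u, v}" using xy uv by simp
      ultimately show "d \<in> (\<lambda>e. \<phi> ` e) ` edges G" by blast
    qed
  qed
  then show ?thesis
    unfolding graph_iso_def verts_remove_isolated[OF G] using \<phi> by (auto simp: remove_isolated_def)
qed


section \<open>Adjacency in the listed graphs\<close>

lemma adj_complete_graph: "{x, y} \<in> edges (complete_graph n) \<longleftrightarrow> x < n \<and> y < n \<and> x \<noteq> y"
  by (auto simp: complete_graph_def nsets_def card_insert_if)

lemma edges_complete_graph:
  "e \<in> edges (complete_graph n) \<Longrightarrow> \<exists>x\<in>verts (complete_graph n). \<exists>y\<in>verts (complete_graph n). e = {x, y}"
  by (auto simp: complete_graph_def nsets_def card_2_iff)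

lemma adj_disjoint_copies:
  "{x, y} \<in> edges (disjoint_copies r (complete_graph n)) \<longleftrightarrow>
    x \<in> {..<r} \<times> {..<n} \<and> y \<in> {..<r} \<times> {..<n} \<and> x \<noteq> y \<and> fst x = fst y"
proof
  assume "{x, y} \<in> edges (disjoint_copies r (complete_graph n))"
  then obtain i e where i: "i < r" "e \<in> edges (complete_graph n)" "{x, y} = Pair i ` e"
    by (auto simp: disjoint_copies_def)
  then obtain a b where "e = {a, b}" "a < n" "b < n" "a \<noteq> b"
    by (auto simp: complete_graph_def nsets_def card_2_iff)
  with i show "x \<in> {..<r} \<times> {..<n} \<and> y \<in> {..<r} \<times> {..<n} \<and> x \<noteq> y \<and> fst x = fst y"
    by (auto simp: doubleton_eq_iff)
next
  assume "x \<in> {..<r} \<times> {..<n} \<and> y \<in> {..<r} \<times> {..<n} \<and> x \<noteq> y \<and> fst x = fst y"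
  then have "{x, y} = Pair (fst x) ` {snd x, snd y}" "fst x < r"
    "{snd x, snd y} \<in> edges (complete_graph n)"
    by (auto simp: adj_complete_graph prod_eq_iff)
  then show "{x, y} \<in> edges (disjoint_copies r (complete_graph n))"
    unfolding disjoint_copies_def snd_conv by blast
qed

lemma edges_disjoint_copies:
  "e \<in> edges (disjoint_copies r (complete_graph n)) \<Longrightarrow>
    \<exists>x\<in>verts (disjoint_copies r (complete_graph n)).
    \<exists>y\<in>verts (disjoint_copies r (complete_graph n)). e = {x, y}"
  by (fastforce simp: disjoint_copies_def complete_graph_def nsets_def card_2_iff)

lemma adj_join_copies:
  "{x, y} \<in> edges (join_copies r (edgeless_graph n)) \<longleftrightarrow>
    x \<in> {..<r} \<times> {..<n} \<and> y \<in> {..<r} \<times> {..<n} \<and> fst x \<noteq> fst y"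
  by (cases x; cases y)
    (auto simp: join_copies_def disjoint_copies_def edgeless_graph_def doubleton_eq_iff)

lemma edges_join_copies:
  "e \<in> edges (join_copies r (edgeless_graph n)) \<Longrightarrow>
    \<exists>x\<in>verts (join_copies r (edgeless_graph n)).
    \<exists>y\<in>verts (join_copies r (edgeless_graph n)). e = {x, y}"
  by (fastforce simp: join_copies_def disjoint_copies_def edgeless_graph_def)

lemma adj_graph_join:
  "{Inl a, Inl b} \<in> edges (graph_join G H) \<longleftrightarrow> {a, b} \<in> edges G"
  "{Inr c, Inr d} \<in> edges (graph_join G H) \<longleftrightarrow> {c, d} \<in> edges H"
  "{Inl a, Inr d} \<in> edges (graph_join G H) \<longleftrightarrow> a \<in> verts G \<and> d \<in> verts H"
  "{Inr c, Inl b} \<in> edges (graph_join G H) \<longleftrightarrow> b \<in> verts G \<and> c \<in> verts H"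
proof -
  have l: "{Inl a, Inl b} = Inl ` e \<longleftrightarrow> {a, b} = e" for a b :: 'a and e
    using inj_image_eq_iff[OF inj_Inl, of "{a, b}" e] by simp
  have r: "{Inr c, Inr d} = Inr ` e \<longleftrightarrow> {c, d} = e" for c d :: 'b and e
    using inj_image_eq_iff[OF inj_Inr, of "{c, d}" e] by simp
  have mixed: "{Inl a, Inr d} \<noteq> Inl ` e" "{Inl a, Inr d} \<noteq> Inr ` e'"
    "{Inr d, Inl a} \<noteq> Inl ` e" "{Inr d, Inl a} \<noteq> Inr ` e'"
    "{Inl a, Inl b} \<noteq> Inr ` e'" "{Inr c, Inr d} \<noteq> Inl ` e" for a b c d e e'
    by blast+
  show "{Inl a, Inl b} \<in> edges (graph_join G H) \<longleftrightarrow> {a, b} \<in> edges G"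
    "{Inr c, Inr d} \<in> edges (graph_join G H) \<longleftrightarrow> {c, d} \<in> edges H"
    "{Inl a, Inr d} \<in> edges (graph_join G H) \<longleftrightarrow> a \<in> verts G \<and> d \<in> verts H"
    "{Inr c, Inl b} \<in> edges (graph_join G H) \<longleftrightarrow> b \<in> verts G \<and> c \<in> verts H"
    by (simp_all add: graph_join_def image_iff l r mixed doubleton_eq_iff)
qed

lemma adj_bipartite:
  "{x, y} \<in> edges (graph_join (edgeless_graph n) (edgeless_graph m)) \<longleftrightarrow>
    x \<in> {..<n} <+> {..<m} \<and> y \<in> {..<n} <+> {..<m} \<and> isl x \<noteq> isl y"
  by (cases x; cases y) (auto simp: adj_graph_join edgeless_graph_def)

lemma adj_join_complete_2:
  "{x, y} \<in> edges (graph_join (complete_graph 2) (edgeless_graph m)) \<longleftrightarrow>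
    x \<in> {..<2} <+> {..<m} \<and> y \<in> {..<2} <+> {..<m} \<and> x \<noteq> y \<and> (isl x \<or> isl y)"
  by (cases x; cases y)
    (simp_all add: adj_graph_join adj_complete_graph, auto simp: edgeless_graph_def complete_graph_def)

lemma edges_graph_join:
  assumes "\<And>e. e \<in> edges G \<Longrightarrow> \<exists>x\<in>verts G. \<exists>y\<in>verts G. e = {x, y}"
    and "e \<in> edges (graph_join G (edgeless_graph m))"
  shows "\<exists>x\<in>verts (graph_join G (edgeless_graph m)).
    \<exists>y\<in>verts (graph_join G (edgeless_graph m)). e = {x, y}"
proof -
  from assms(2) consider d where "d \<in> edges G" "e = Inl ` d"
    | u v where "u \<in> verts G" "v < m" "e = {Inl u, Inr v}"
    by (auto simp: graph_join_def edgeless_graph_def)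
  then show ?thesis
  proof cases
    case 1
    moreover from 1 obtain x y where "x \<in> verts G" "y \<in> verts G" "d = {x, y}"
      using assms(1) by blast
    ultimately have "Inl x \<in> verts G <+> verts (edgeless_graph m)"
      "Inl y \<in> verts G <+> verts (edgeless_graph m)" "e = {Inl x, Inl y}"
      by auto
    then show ?thesis unfolding graph_join_def fst_conv by blast
  next
    case 2
    then have "Inl u \<in> verts G <+> verts (edgeless_graph m)"
      "Inr v \<in> verts G <+> verts (edgeless_graph m)"
      by (auto simp: edgeless_graph_def)
    with 2(3) show ?thesis unfolding graph_join_def fst_conv by blast
  qed
qed

lemma adj_cycle_graph:
  "{x, y} \<in> edges (cycle_graph 5) \<longleftrightarrow> x < 5 \<and> y < 5 \<and> (y = Suc x mod 5 \<or> x = Suc y mod 5)"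
  by (auto simp: cycle_graph_def doubleton_eq_iff)

lemma edges_cycle_graph:
  "e \<in> edges (cycle_graph 5) \<Longrightarrow> \<exists>x\<in>verts (cycle_graph 5). \<exists>y\<in>verts (cycle_graph 5). e = {x, y}"
  by (force simp: cycle_graph_def)

lemma verts_simps:
  "verts (complete_graph n) = {..<n}"
  "verts (disjoint_copies r G) = {..<r} \<times> verts G"
  "verts (join_copies r G) = {..<r} \<times> verts G"
  "verts (edgeless_graph n) = {..<n}"
  "verts (graph_join G H) = verts G <+> verts H"
  "verts (cycle_graph n) = {..<n}"
  by (simp_all add: complete_graph_def disjoint_copies_def join_copies_def edgeless_graph_def
      graph_join_def cycle_graph_def)


section \<open>The listed graphs have a greatest merge\<close>

lemma swap_exists:
  assumes "i \<in> A" "k \<in> A"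
  obtains s where "inj s" "s ` A \<subseteq> A" "s i = k" "\<And>x. x \<noteq> i \<Longrightarrow> x \<noteq> k \<Longrightarrow> s x = x"
proof
  show "inj (id(i := k, k := i))" by (auto simp: inj_on_def split: if_splits)
qed (use assms in auto)

lemma double_swap_exists:
  assumes "i \<in> A" "j \<in> A" "k \<in> A" "l \<in> A" "i \<noteq> j" "k \<noteq> l"
  obtains s where "inj s" "s ` A \<subseteq> A" "s i = k" "s j = l"
proof -
  obtain s where s: "inj s" "s ` A \<subseteq> A" "s i = k"
    using swap_exists[OF assms(1,3)] by metis
  have "s j \<in> A" using s(2) assms(2) by blast
  then obtain t where t: "inj t" "t ` A \<subseteq> A" "t (s j) = l"
      "\<And>x. x \<noteq> s j \<Longrightarrow> x \<noteq> l \<Longrightarrow> t x = x"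
    using swap_exists[OF _ assms(4)] by metis
  \<comment> \<open>The second transposition moves at most \<open>s j\<close> and \<open>l\<close>,
    so \<open>k\<close> stays in place.\<close>
  have "k \<noteq> s j" using s(1,3) assms(5) by (auto simp: inj_eq)
  then show ?thesis
    using s t assms(6) by (intro that[of "t \<circ> s"]) (auto intro: inj_compose)
qed

text \<open>Maps respecting equality of first coordinates are symmetries both of joins of edgeless
  graphs and of disjoint unions of complete graphs, so one construction serves both
  families.\<close>

lemma fibrewise_swap_exists:
  fixes A :: "'a set" and B :: "'b set"
  assumes "x \<in> A \<times> B" "y \<in> A \<times> B" "x' \<in> A \<times> B" "y' \<in> A \<times> B" "fst x \<noteq> fst y" "fst x' \<noteq> fst y'"
  obtains \<pi> where "inj \<pi>" "\<pi> ` (A \<times> B) \<subseteq> A \<times> B" "\<pi> x = x'" "\<pi> y = y'"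
    "\<And>u v. fst (\<pi> u) = fst (\<pi> v) \<longleftrightarrow> fst u = fst v"
proof -
  obtain s where s: "inj s" "s ` A \<subseteq> A" "s (fst x) = fst x'" "s (fst y) = fst y'"
    using double_swap_exists[of "fst x" A "fst y" "fst x'" "fst y'"] assms by (metis mem_Times_iff)
  obtain t where t: "inj t" "t ` B \<subseteq> B" "t (snd x) = snd x'"
    using swap_exists[of "snd x" B "snd x'"] assms by (metis mem_Times_iff)
  obtain t' where t': "inj t'" "t' ` B \<subseteq> B" "t' (snd y) = snd y'"
    using swap_exists[of "snd y" B "snd y'"] assms by (metis mem_Times_iff)
  \<comment> \<open>\<open>s\<close> permutes the fibres. The fibre of \<open>x\<close> gets its own
    map \<open>t\<close>, so that both second coordinates can be prescribed.\<close>
  let ?\<pi> = "\<lambda>(a, b). (s a, if a = fst x then t b else t' b)"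
  show ?thesis
  proof (rule that[of ?\<pi>])
    show "inj ?\<pi>"
    proof (rule injI)
      fix p q assume eq: "?\<pi> p = ?\<pi> q"
      then have "fst p = fst q" by (simp add: case_prod_beta inj_eq[OF s(1)])
      moreover from this and eq have "snd p = snd q"
        by (simp add: case_prod_beta inj_eq[OF t(1)] inj_eq[OF t'(1)] split: if_splits)
      ultimately show "p = q" by (rule prod_eqI)
    qed
    show "?\<pi> ` (A \<times> B) \<subseteq> A \<times> B" using s(2) t(2) t'(2) by (auto simp: image_subset_iff)
    show "?\<pi> x = x'" "?\<pi> y = y'"
      using s t t' assms(5) by (auto simp: case_prod_beta prod_eq_iff)
    show "fst (?\<pi> u) = fst (?\<pi> v) \<longleftrightarrow> fst u = fst v" for u v
      using s(1) by (auto simp: case_prod_beta inj_eq)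
  qed
qed

section \<open>Bounds for merges of a graph function\<close>

context edge_set
begin

text \<open>An injective map sending edges to edges permutes the finite edge set, so preserving
  adjacency in one direction is enough.\<close>

lemma merge_le_graph_automorphism:
  assumes inj: "inj_on \<pi> V" and adj: "\<And>u v. u \<in> nbr v \<Longrightarrow> \<pi> u \<in> nbr (\<pi> v)"
    and "k = \<pi> i" "l = \<pi> j"
  shows "merge par k l \<sqsubseteq> merge par i j"
proof -
  have "(\<lambda>e. \<pi> ` e) ` E \<subseteq> E"
  proof
    fix d assume "d \<in> (\<lambda>e. \<pi> ` e) ` E"
    then obtain e where "e \<in> E" "d = \<pi> ` e" by blast
    moreover from this obtain u v where "e = {u, v}" using card_edge[of e] by (auto simp: card_2_iff)
    ultimately show "d \<in> E" using adj[of u v] by (simp add: nbr_def)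
  qed
  moreover have "inj_on (\<lambda>e. \<pi> ` e) E"
  proof (rule inj_onI)
    fix d e assume "d \<in> E" "e \<in> E" "\<pi> ` d = \<pi> ` e"
    then show "d = e" using inj_on_image_eq_iff[OF inj, of d e] by blast
  qed
  ultimately have "(\<lambda>e. \<pi> ` e) ` E = E" using finite_edges by (intro endo_inj_surj)
  with edge_parity_image[OF inj] show ?thesis
    unfolding assms(3,4) by (intro merge_le_automorphism) simp
qed

text \<open>The lost variable is \<open>k\<close>; merging it with a neighbour reduces a non-edge to
  an edge.\<close>

lemma twins_merge_le:
  assumes "nbr k = nbr l" "k \<noteq> l" "w \<in> nbr k"
  shows "merge par k l \<sqsubseteq> merge par k w"
proof (rule merge_le_inessential)
  show "k \<notin> ess (merge par k l)" using assms by (intro inessential_if_twins)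
  show "w \<noteq> k" "w \<noteq> l" using assms not_nbr_self[of k] not_nbr_self[of l] by blast+
qed fact

lemma nbr_pair_merge_le:
  assumes "nbr u = {k, l}" "k \<noteq> l" "w \<noteq> u" "w \<noteq> l"
  shows "merge par k l \<sqsubseteq> merge par u w"
proof (rule merge_le_inessential)
  show "u \<notin> ess (merge par k l)" using assms by (intro inessential_if_nbr_eq_pair)
  show "u \<noteq> l" using assms(1) not_nbr_self[of u] by blast
qed fact+

lemma greatest_mergeI:
  assumes "i \<in> V" "j \<in> V" "i \<noteq> j"
    and "\<And>k l. k \<in> V \<Longrightarrow> l \<in> V \<Longrightarrow> k \<noteq> l \<Longrightarrow> merge par k l \<sqsubseteq> merge par i j"
  shows "greatest_merge par"
  unfolding greatest_merge_def ess_par using assms by blast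

text \<open>A lossy non-edge is bounded by the merge of an edge: \<open>k\<close> with a neighbour
  if \<open>k\<close> and \<open>l\<close> are twins, \<open>u\<close> with \<open>k\<close> if
  \<open>nbr u = {k, l}\<close>. The disjunction lets each edge be taken in the convenient
  order.\<close>

lemma greatest_mergeI_edge:
  assumes "i \<in> nbr j"
    and edge: "\<And>k l. k \<in> nbr l \<Longrightarrow> merge par k l \<sqsubseteq> merge par i j \<or> merge par l k \<sqsubseteq> merge par i j"
    and nonedge: "\<And>k l. k \<in> V \<Longrightarrow> l \<in> V \<Longrightarrow> k \<noteq> l \<Longrightarrow> k \<notin> nbr l \<Longrightarrow> lossy k l"
  shows "greatest_merge par"
proof (rule greatest_mergeI)
  show "i \<in> V" "j \<in> V" using nbr_in_V[OF assms(1)] .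
  show "i \<noteq> j" using assms(1) by auto
  have edge': "merge par k l \<sqsubseteq> merge par i j" if "k \<in> nbr l" for k l
    using edge[OF that] subst_le_trans[OF merge_commute[of par k l]] by blast
  fix k l assume kl: "k \<in> V" "l \<in> V" "k \<noteq> l"
  show "merge par k l \<sqsubseteq> merge par i j"
  proof (cases "k \<in> nbr l")
    case False
    then consider "nbr k = nbr l" | u where "nbr u = {k, l}"
      using nonedge[OF kl] by (auto simp: lossy_def)
    then show ?thesis
    proof cases
      case 1
      obtain w where w: "w \<in> nbr k" using kl(1) in_V_iff by blast
      then have "merge par k w \<sqsubseteq> merge par i j" using edge' nbr_sym by blast
      with twins_merge_le[OF 1 kl(3) w] show ?thesis by (rule subst_le_trans)
    next
      case 2
      then have "u \<noteq> k" "u \<in> nbr k" using not_nbr_self[of u] nbr_sym by blast+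
      then have "merge par k l \<sqsubseteq> merge par u k"
        using nbr_pair_merge_le[OF 2 kl(3), of k] kl(3) by blast
      moreover have "merge par u k \<sqsubseteq> merge par i j" using edge' \<open>u \<in> nbr k\<close> by blast
      ultimately show ?thesis by (rule subst_le_trans)
    qed
  qed (rule edge')
qed

end

section \<open>Verification for each listed graph\<close>

lemma greatest_merge_complete_graph:
  assumes "edge_set (edges (complete_graph n))" "2 \<le> n"
  shows "greatest_merge (edge_parity (edges (complete_graph n)))"
proof -
  interpret edge_set "edges (complete_graph n)" by fact
  have nbr: "u \<in> nbr v \<longleftrightarrow> u < n \<and> v < n \<and> u \<noteq> v" for u v
    by (simp add: nbr_def adj_complete_graph)
  have V: "v < n" if "v \<in> V" for v using that in_V_iff[of v] nbr by blast
  show ?thesis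
  proof (rule greatest_mergeI_edge)
    show "0 \<in> nbr 1" using assms(2) by (simp add: nbr)
    fix k l assume "k \<in> nbr l"
    then obtain s where s: "inj s" "s ` {..<n} \<subseteq> {..<n}" "s 0 = k" "s 1 = l"
      using double_swap_exists[of 0 "{..<n}" 1 k l] assms(2) by (auto simp: nbr)
    then have "merge par k l \<sqsubseteq> merge par 0 1"
      by (intro merge_le_graph_automorphism[of s]) (auto simp: nbr inj_eq intro: inj_on_subset)
    then show "merge par k l \<sqsubseteq> merge par 0 1 \<or> merge par l k \<sqsubseteq> merge par 0 1" ..
  qed (use V nbr in blast)
qed

lemma greatest_merge_join_copies:
  assumes "edge_set (edges (join_copies r (edgeless_graph n)))" "2 \<le> r" "1 \<le> n"
  shows "greatest_merge (edge_parity (edges (join_copies r (edgeless_graph n))))"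
proof -
  let ?W = "{..<r} \<times> {..<n}"
  interpret edge_set "edges (join_copies r (edgeless_graph n))" by fact
  have nbr: "u \<in> nbr v \<longleftrightarrow> u \<in> ?W \<and> v \<in> ?W \<and> fst u \<noteq> fst v" for u v
    by (simp add: nbr_def adj_join_copies)
  show ?thesis
  proof (rule greatest_mergeI_edge)
    show 0: "(0, 0) \<in> nbr (1, 0)" using assms(2,3) by (simp add: nbr)
    fix k l
    show "merge par k l \<sqsubseteq> merge par (0, 0) (1, 0) \<or> merge par l k \<sqsubseteq> merge par (0, 0) (1, 0)"
      if "k \<in> nbr l"
    proof -
      have W: "(0, 0) \<in> ?W" "(1, 0) \<in> ?W" "k \<in> ?W" "l \<in> ?W"
        "fst (0 :: nat, 0 :: nat) \<noteq> fst (1 :: nat, 0 :: nat)" "fst k \<noteq> fst l"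
        using 0 that unfolding nbr by simp_all
      obtain \<pi> where \<pi>: "inj \<pi>" "\<pi> ` ?W \<subseteq> ?W" "\<pi> (0, 0) = k" "\<pi> (1, 0) = l"
        "\<And>u v. fst (\<pi> u) = fst (\<pi> v) \<longleftrightarrow> fst u = fst v"
        by (rule fibrewise_swap_exists[OF W]) blast
      have "merge par k l \<sqsubseteq> merge par (0, 0) (1, 0)"
      proof (rule merge_le_graph_automorphism)
        show "inj_on \<pi> V" using \<pi>(1) by (rule inj_on_subset) simp
        show "\<pi> u \<in> nbr (\<pi> v)" if "u \<in> nbr v" for u v
          using that \<pi>(2,5) unfolding nbr by blast
      qed (rule \<pi>(3,4)[symmetric])+
      then show ?thesis ..
    qed
    assume "k \<in> V" "l \<in> V" "k \<notin> nbr l"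
    then have "k \<in> ?W" "l \<in> ?W" using in_V_iff nbr by blast+
    then have "nbr k = nbr l" using \<open>k \<notin> nbr l\<close> by (auto simp: set_eq_iff nbr)
    then show "lossy k l" by (simp add: lossy_def)
  qed
qed

lemma greatest_merge_bipartite:
  assumes "edge_set (edges (graph_join (edgeless_graph n) (edgeless_graph m)))" "1 \<le> n" "1 \<le> m"
  shows "greatest_merge (edge_parity (edges (graph_join (edgeless_graph n) (edgeless_graph m))))"
proof -
  interpret edge_set "edges (graph_join (edgeless_graph n) (edgeless_graph m))" by fact
  let ?W = "{..<n} <+> {..<m}"
  have nbr: "u \<in> nbr v \<longleftrightarrow> u \<in> ?W \<and> v \<in> ?W \<and> isl u \<noteq> isl v" for u v
    by (simp add: nbr_def adj_bipartite)
  have main: "merge par (Inl a) (Inr b) \<sqsubseteq> merge par (Inl 0) (Inr 0)" if "a < n" "b < m" for a b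
  proof -
    obtain s where s: "inj s" "s ` {..<n} \<subseteq> {..<n}" "s 0 = a"
      using swap_exists[of 0 "{..<n}" a] assms \<open>a < n\<close> by auto
    obtain t where t: "inj t" "t ` {..<m} \<subseteq> {..<m}" "t 0 = b"
      using swap_exists[of 0 "{..<m}" b] assms \<open>b < m\<close> by auto
    show ?thesis
    proof (rule merge_le_graph_automorphism)
      show "inj_on (map_sum s t) V"
        using s(1) t(1) by (intro inj_on_subset[OF sum.inj_map]) auto
      show "map_sum s t u \<in> nbr (map_sum s t v)" if "u \<in> nbr v" for u v
        using that s(2) t(2) by (cases u; cases v) (auto simp: nbr)
    qed (simp_all add: s t)
  qed
  show ?thesis
  proof (rule greatest_mergeI_edge)
    show "Inl 0 \<in> nbr (Inr 0)" using assms(2,3) by (auto simp: nbr)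
    fix k l
    show "merge par k l \<sqsubseteq> merge par (Inl 0) (Inr 0) \<or> merge par l k \<sqsubseteq> merge par (Inl 0) (Inr 0)"
      if "k \<in> nbr l" using that main by (cases k; cases l) (auto simp: nbr)
    assume "k \<in> V" "l \<in> V" "k \<notin> nbr l"
    then have "k \<in> ?W" "l \<in> ?W" using in_V_iff nbr by blast+
    then have "nbr k = nbr l" using \<open>k \<notin> nbr l\<close> by (auto simp: set_eq_iff nbr)
    then show "lossy k l" by (simp add: lossy_def)
  qed
qed

text \<open>The symmetries used act on each side separately and do not reach the edge inside the
  complete part. That edge is lossy, being the neighbourhood of each vertex on the other side, so
  \<open>greatest_mergeI\<close> is applied directly.\<close>

lemma greatest_merge_join_complete_2:
  assumes "edge_set (edges (graph_join (complete_graph 2) (edgeless_graph m)))" "1 \<le> m"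
  shows "greatest_merge (edge_parity (edges (graph_join (complete_graph 2) (edgeless_graph m))))"
proof -
  interpret edge_set "edges (graph_join (complete_graph 2) (edgeless_graph m))" by fact
  let ?W = "{..<2} <+> {..<m}"
  have nbr: "u \<in> nbr v \<longleftrightarrow> u \<in> ?W \<and> v \<in> ?W \<and> u \<noteq> v \<and> (isl u \<or> isl v)" for u v
    by (simp add: nbr_def adj_join_complete_2)
  have lr: "merge par (Inl a) (Inr b) \<sqsubseteq> merge par (Inl 0) (Inr 0)" if "a < 2" "b < m" for a b
  proof -
    obtain s where s: "inj s" "s ` {..<2 :: nat} \<subseteq> {..<2 :: nat}" "s 0 = a"
      using swap_exists[of 0 "{..<2}" a] \<open>a < 2\<close> by auto
    obtain t where t: "inj t" "t ` {..<m} \<subseteq> {..<m}" "t 0 = b"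
      using swap_exists[of 0 "{..<m}" b] assms \<open>b < m\<close> by auto
    show ?thesis
    proof (rule merge_le_graph_automorphism)
      show "inj_on (map_sum s t) V"
        using s(1) t(1) by (intro inj_on_subset[OF sum.inj_map]) auto
      show "map_sum s t u \<in> nbr (map_sum s t v)" if "u \<in> nbr v" for u v
        using that s(1,2) t(2) by (cases u; cases v) (auto simp: nbr inj_eq)
    qed (simp_all add: s t)
  qed
  have rl: "merge par (Inr b) (Inl a) \<sqsubseteq> merge par (Inl 0) (Inr 0)" if "a < 2" "b < m" for a b
    using merge_commute lr[OF that] by (rule subst_le_trans)
  show ?thesis
  proof (rule greatest_mergeI)
    have "Inl 0 \<in> nbr (Inr 0)" using assms(2) by (auto simp: nbr)
    then show "Inl 0 \<in> V" "Inr 0 \<in> V" using nbr_in_V by blast+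
    fix k l assume kl: "k \<in> V" "l \<in> V" "k \<noteq> l"
    then have W: "k \<in> ?W" "l \<in> ?W" using in_V_iff nbr by blast+
    then consider a b where "k = Inl a" "l = Inr b" "a < 2" "b < m"
      | a b where "k = Inr b" "l = Inl a" "a < 2" "b < m"
      | a b where "k = Inl a" "l = Inl b" "a < 2" "b < 2"
      | a b where "k = Inr a" "l = Inr b" "a < m" "b < m"
      by blast
    then show "merge par k l \<sqsubseteq> merge par (Inl 0) (Inr 0)"
    proof cases
      case 3
      then have "a = 0 \<and> b = 1 \<or> a = 1 \<and> b = 0" using kl(3) by auto
      then have "nbr (Inr 0) = {k, l}" using 3 assms(2) by (auto simp: set_eq_iff nbr less_2_cases_iff)
      from nbr_pair_merge_le[OF this kl(3), of k] kl(3) 3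
      have "merge par k l \<sqsubseteq> merge par (Inr 0) k" by simp
      moreover have "merge par (Inr 0) k \<sqsubseteq> merge par (Inl 0) (Inr 0)" using rl 3 assms(2) by simp
      ultimately show ?thesis by (rule subst_le_trans)
    next
      case 4
      then have "nbr k = nbr l" "Inl 0 \<in> nbr k" by (auto simp: set_eq_iff nbr)
      from twins_merge_le[OF this(1) kl(3) this(2)]
      have "merge par k l \<sqsubseteq> merge par k (Inl 0)" .
      moreover have "merge par k (Inl 0) \<sqsubseteq> merge par (Inl 0) (Inr 0)" using rl 4 by simp
      ultimately show ?thesis by (rule subst_le_trans)
    qed (simp_all add: lr rl)
  qed simp
qed

text \<open>Here the greatest merge is that of a non-edge between two triangles. An edge is the
  neighbourhood of the third vertex of its triangle, so its merge is bounded by merging that vertex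
  with one of another triangle.\<close>

lemma greatest_merge_triangles:
  assumes "edge_set (edges (disjoint_copies r (complete_graph 3)))" "2 \<le> r"
  shows "greatest_merge (edge_parity (edges (disjoint_copies r (complete_graph 3))))"
proof -
  let ?W = "{..<r} \<times> {..<3 :: nat}"
  interpret edge_set "edges (disjoint_copies r (complete_graph 3))" by fact
  have nbr: "u \<in> nbr v \<longleftrightarrow> u \<in> ?W \<and> v \<in> ?W \<and> u \<noteq> v \<and> fst u = fst v" for u v
    by (simp add: nbr_def adj_disjoint_copies)
  have VW: "v \<in> ?W" if "v \<in> V" for v using that in_V_iff nbr by blast
  have nonadj: "merge par k l \<sqsubseteq> merge par (0, 0) (1, 0)" if kl: "k \<in> ?W" "l \<in> ?W" "fst k \<noteq> fst l" for k l
  proof -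
    have W: "(0, 0) \<in> ?W" "(1, 0) \<in> ?W"
      "fst (0 :: nat, 0 :: nat) \<noteq> fst (1 :: nat, 0 :: nat)" using assms(2) by auto
    obtain \<pi> where \<pi>: "inj \<pi>" "\<pi> ` ?W \<subseteq> ?W" "\<pi> (0, 0) = k" "\<pi> (1, 0) = l"
      "\<And>u v. fst (\<pi> u) = fst (\<pi> v) \<longleftrightarrow> fst u = fst v"
      by (rule fibrewise_swap_exists[OF W(1,2) kl(1,2) W(3) kl(3)]) blast
    show ?thesis
    proof (rule merge_le_graph_automorphism)
      show "inj_on \<pi> V" using \<pi>(1) by (rule inj_on_subset) simp
      show "\<pi> u \<in> nbr (\<pi> v)" if "u \<in> nbr v" for u v
        using that \<pi>(1,2,5) unfolding nbr by (meson image_subset_iff injD)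
    qed (rule \<pi>(3,4)[symmetric])+
  qed
  show ?thesis
  proof (rule greatest_mergeI)
    have "(0, 1) \<in> nbr (0, 0)" "(1, 1) \<in> nbr (1, 0)" using assms(2) by (auto simp: nbr)
    then show "(0, 0) \<in> V" "(1, 0) \<in> V" using nbr_in_V by blast+
    fix k l assume "k \<in> V" "l \<in> V" and ne: "k \<noteq> l"
    then have W: "k \<in> ?W" "l \<in> ?W" using VW by blast+
    show "merge par k l \<sqsubseteq> merge par (0, 0) (1, 0)"
    proof (cases "fst k = fst l")
      case True
      obtain a b c where k: "k = (a, b)" and l: "l = (a, c)" using True by (metis prod.collapse)
      have bc: "a < r" "b < 3" "c < 3" "b \<noteq> c" using W ne k l by auto
      \<comment> \<open>The third vertex of the triangle, as the labels 0, 1, 2 add up to 3.\<close>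
      define d where "d = 3 - b - c"
      have d: "d < 3" "d \<noteq> b" "d \<noteq> c" "\<And>x. x < 3 \<Longrightarrow> x \<noteq> d \<Longrightarrow> x = b \<or> x = c"
        using bc unfolding d_def by arith+
      have "nbr (a, d) = {k, l}"
        using d bc unfolding set_eq_iff nbr k l by auto
      moreover define a' :: nat where "a' = (if a = 0 then 1 else 0)"
      then have a': "a' < r" "a' \<noteq> a" using assms(2) by auto
      ultimately have "merge par k l \<sqsubseteq> merge par (a, d) (a', 0)"
        using ne l by (intro nbr_pair_merge_le) auto
      moreover have "merge par (a, d) (a', 0) \<sqsubseteq> merge par (0, 0) (1, 0)"
        using a' bc d by (intro nonadj) auto
      ultimately show ?thesis by (rule subst_le_trans)
    qed (use nonadj W in blast)
  qed simp
qed

lemma greatest_merge_cycle_graph: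
  assumes "edge_set (edges (cycle_graph 5))"
  shows "greatest_merge (edge_parity (edges (cycle_graph 5)))"
proof -
  interpret edge_set "edges (cycle_graph 5)" by fact
  have nbr: "u \<in> nbr v \<longleftrightarrow> u < 5 \<and> v < 5 \<and> (v = Suc u mod 5 \<or> u = Suc v mod 5)" for u v
    by (simp add: nbr_def adj_cycle_graph)
  have five: "x \<in> {0, 1, 2, 3, 4}" if "x < 5" for x :: nat using that by auto
  have rotate: "merge par k (Suc k mod 5) \<sqsubseteq> merge par 0 1" if "k < 5" for k
  proof (rule merge_le_graph_automorphism)
    have "V \<subseteq> {..<5}" using in_V_iff nbr by blast
    moreover have "inj_on (\<lambda>x. (x + k) mod 5) {..<5}"
    proof (rule inj_onI)
      fix x y assume "x \<in> {..<5}" "y \<in> {..<5}" "(x + k) mod 5 = (y + k) mod 5"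
      then show "x = y" using five[of x] five[of y] five[OF that] by auto
    qed
    ultimately show "inj_on (\<lambda>x. (x + k) mod 5) V" by (rule inj_on_subset[rotated])
    show "(u + k) mod 5 \<in> nbr ((v + k) mod 5)" if "u \<in> nbr v" for u v
      using that unfolding nbr by (auto simp: mod_simps)
  qed (use that in auto)
  have pairs: "nbr 0 = {1, 4}" "nbr 1 = {0, 2}" "nbr 2 = {1, 3}" "nbr 3 = {2, 4}" "nbr 4 = {3, 0}"
  proof -
    have "nbr v = {u \<in> {0, 1, 2, 3, 4}. v = Suc u mod 5 \<or> u = Suc v mod 5}" if "v < 5" for v
      using that five nbr by fastforce
    then show "nbr 0 = {1, 4}" "nbr 1 = {0, 2}" "nbr 2 = {1, 3}" "nbr 3 = {2, 4}" "nbr 4 = {3, 0}"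
      by auto
  qed
  show ?thesis
  proof (rule greatest_mergeI_edge)
    show "0 \<in> nbr 1" by (simp add: nbr)
    fix k l
    show "merge par k l \<sqsubseteq> merge par 0 1 \<or> merge par l k \<sqsubseteq> merge par 0 1" if "k \<in> nbr l"
      using that rotate unfolding nbr by metis
    assume "k \<in> V" "l \<in> V" and kl: "k \<noteq> l" "k \<notin> nbr l"
    then have "k \<in> {0, 1, 2, 3, 4}" "l \<in> {0, 1, 2, 3, 4}" using in_V_iff nbr five by blast+
    \<comment> \<open>Two non-adjacent vertices of the 5-cycle are the two neighbours of a third
      one.\<close>
    with kl have "{k, l} \<in> {nbr 0, nbr 1, nbr 2, nbr 3, nbr 4}"
      unfolding pairs by (elim insertE emptyE) (simp_all add: pairs pairs(2)[unfolded One_nat_def] doubleton_eq_iff)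
    then show "lossy k l" by (auto simp: lossy_def)
  qed
qed


section \<open>Graphs with a greatest merge are listed\<close>

text \<open>A numbering of the classes is combined with one inside each class; equal class sizes
  make the image a full rectangle.\<close>

lemma class_coordinates:
  assumes "finite V" "\<And>v. v \<in> V \<Longrightarrow> card {u \<in> V. c u = c v} = k"
  obtains \<phi> where "bij_betw \<phi> V ({..<card (c ` V)} \<times> {..<k})"
    "\<And>u v. u \<in> V \<Longrightarrow> v \<in> V \<Longrightarrow> fst (\<phi> u) = fst (\<phi> v) \<longleftrightarrow> c u = c v"
proof -
  obtain h where h: "bij_betw h (c ` V) {..<card (c ` V)}"
    using assms(1) ex_bij_betw_finite_nat[of "c ` V"] by (auto simp: atLeast0LessThan)
  have "\<forall>t\<in>c ` V. \<exists>g. bij_betw g {u \<in> V. c u = t} {..<k}"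
  proof
    fix t assume "t \<in> c ` V"
    then have "finite {u \<in> V. c u = t}" "card {u \<in> V. c u = t} = k" using assms by auto
    then show "\<exists>g. bij_betw g {u \<in> V. c u = t} {..<k}"
      using ex_bij_betw_finite_nat[of "{u \<in> V. c u = t}"] by (auto simp: atLeast0LessThan)
  qed
  then obtain g where g: "\<And>t. t \<in> c ` V \<Longrightarrow> bij_betw (g t) {u \<in> V. c u = t} {..<k}" by metis
  let ?\<phi> = "\<lambda>v. (h (c v), g (c v) v)"
  have h_eq: "h (c u) = h (c v) \<longleftrightarrow> c u = c v" if "u \<in> V" "v \<in> V" for u v
    using that h inj_on_eq_iff[of h "c ` V"] by (auto simp: bij_betw_def)
  have "inj_on ?\<phi> V"
  proof (rule inj_onI)
    fix u v assume uv: "u \<in> V" "v \<in> V" "?\<phi> u = ?\<phi> v"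
    then have "c u = c v" using h_eq by simp
    with uv g[of "c v"] show "u = v" by (auto simp: bij_betw_def inj_on_def)
  qed
  moreover have "?\<phi> ` V = {..<card (c ` V)} \<times> {..<k}"
  proof
    show "?\<phi> ` V \<subseteq> {..<card (c ` V)} \<times> {..<k}"
      using bij_betwE[OF h] bij_betwE[OF g] by auto
    show "{..<card (c ` V)} \<times> {..<k} \<subseteq> ?\<phi> ` V"
    proof (rule subrelI)
      fix a b assume ab: "(a, b) \<in> {..<card (c ` V)} \<times> {..<k}"
      then obtain t where t: "t \<in> c ` V" "a = h t" using h unfolding bij_betw_def by blast
      have "b \<in> g t ` {u \<in> V. c u = t}" using g[OF t(1)] ab by (simp add: bij_betw_def)
      then obtain u where "u \<in> V" "c u = t" "b = g t u" by blast
      with t show "(a, b) \<in> ?\<phi> ` V" by auto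
    qed
  qed
  ultimately have "bij_betw ?\<phi> V ({..<card (c ` V)} \<times> {..<k})" by (simp add: bij_betw_def)
  then show ?thesis using h_eq by (intro that) auto
qed

lemma two_le_card: "finite A \<Longrightarrow> x \<in> A \<Longrightarrow> y \<in> A \<Longrightarrow> x \<noteq> y \<Longrightarrow> 2 \<le> card A"
  using card_mono[of A "{x, y}"] by simp

section \<open>Isomorphisms onto the listed graphs\<close>

lemma iso_triangles:
  assumes G: "is_graph G"
    and lossy: "\<And>k l. k \<in> edge_set.nbr (edges G) l \<Longrightarrow> edge_set.lossy (edges G) k l"
    and ex: "\<exists>i\<in>\<Union>(edges G). \<exists>j\<in>\<Union>(edges G). i \<noteq> j \<and> i \<notin> edge_set.nbr (edges G) j"
  shows "\<exists>n\<ge>2. graph_iso (remove_isolated G) (disjoint_copies n (complete_graph 3))"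
proof -
  interpret edge_set "edges G" using edge_set_graph[OF G] .
  note Union_iff [simp del]
  \<comment> \<open>Closed neighbourhoods are the triangles and serve as class labels.\<close>
  define c where "c v = insert v (nbr v)" for v
  have c: "card (c v) = 3 \<and> (\<forall>u\<in>c v. c u = c v)" if "v \<in> V" for v
  proof -
    obtain u w where *: "u \<noteq> v" "w \<noteq> v" "u \<noteq> w"
      and n: "nbr v = {u, w}" "nbr u = {v, w}" "nbr w = {u, v}"
      using triangles[OF lossy \<open>v \<in> V\<close>] by metis
    then have "c v = {v, u, w}" "c u = {v, u, w}" "c w = {v, u, w}" by (auto simp: c_def)
    with * show ?thesis by simp
  qed
  have class_iff: "c u = c v \<longleftrightarrow> u \<in> c v" if "u \<in> V" "v \<in> V" for u v
    using c[OF that(2)] by (auto simp: c_def)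
  have cV: "c v \<subseteq> V" if "v \<in> V" for v using that nbr_subset[of v] unfolding c_def by blast
  have card3: "card {u \<in> V. c u = c v} = 3" if "v \<in> V" for v
  proof -
    have "{u \<in> V. c u = c v} = c v" using class_iff that cV by blast
    then show ?thesis using c[OF that] by simp
  qed
  obtain \<phi> where \<phi>: "bij_betw \<phi> V ({..<card (c ` V)} \<times> {..<3 :: nat})"
    and fst: "\<And>u v. u \<in> V \<Longrightarrow> v \<in> V \<Longrightarrow> fst (\<phi> u) = fst (\<phi> v) \<longleftrightarrow> c u = c v"
    by (rule class_coordinates[OF finite_V card3]) (assumption, blast)
  obtain i j where ij: "i \<in> V" "j \<in> V" "i \<noteq> j" "i \<notin> nbr j" using ex by blast
  have "i \<notin> c j" using ij(3,4) by (simp add: c_def)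
  then have "c i \<noteq> c j" using class_iff[OF ij(1,2)] by blast
  then have "2 \<le> card (c ` V)"
    using ij finite_V by (intro two_le_card[of _ "c i" "c j"]) blast+
  moreover have "graph_iso (remove_isolated G) (disjoint_copies (card (c ` V)) (complete_graph 3))"
  proof (rule graph_isoI[OF G])
    show "bij_betw \<phi> V (verts (disjoint_copies (card (c ` V)) (complete_graph 3)))"
      using \<phi> by (simp add: verts_simps)
    fix u v assume uv: "u \<in> V" "v \<in> V"
    have "{u, v} \<in> edges G \<longleftrightarrow> u \<noteq> v \<and> c u = c v"
      unfolding class_iff[OF uv] using not_nbr_self[of v] by (auto simp: c_def nbr_def)
    then show "{u, v} \<in> edges G \<longleftrightarrow> {\<phi> u, \<phi> v} \<in> edges (disjoint_copies (card (c ` V)) (complete_graph 3))"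
      unfolding adj_disjoint_copies using fst[OF uv] uv \<phi> inj_on_eq_iff[of \<phi> V u v]
      by (auto simp: bij_betw_def)
  qed (rule edges_disjoint_copies)
  ultimately show ?thesis by blast
qed

lemma iso_cycle:
  assumes G: "is_graph G" and d: "distinct [a, b, c, d, e]" and V: "\<Union>(edges G) = {a, b, c, d, e}"
    and n: "edge_set.nbr (edges G) a = {b, e}" "edge_set.nbr (edges G) b = {a, c}"
      "edge_set.nbr (edges G) c = {b, d}" "edge_set.nbr (edges G) d = {c, e}"
      "edge_set.nbr (edges G) e = {d, a}"
  shows "graph_iso (remove_isolated G) (cycle_graph 5)"
proof -
  interpret edge_set "edges G" using edge_set_graph[OF G] .
  define \<phi> :: "'a \<Rightarrow> nat" where "\<phi> v = (if v = a then 0 else if v = b then 1 else if v = c then 2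
    else if v = d then 3 else 4)" for v
  \<comment> \<open>This supplies the inequalities in the opposite orientation for the case
    check.\<close>
  have d': "distinct [e, d, c, b, a]" using d by auto
  have val: "\<phi> a = 0" "\<phi> b = 1" "\<phi> c = 2" "\<phi> d = 3" "\<phi> e = 4"
    using d by (auto simp: \<phi>_def)
  show ?thesis
  proof (rule graph_isoI[OF G])
    have "{..<5} = {0, 1, 2, 3, 4 :: nat}" by auto
    then show "bij_betw \<phi> V (verts (cycle_graph 5))"
      unfolding verts_simps V bij_betw_def by (auto simp: val inj_on_def)
    fix u v assume "u \<in> V" "v \<in> V"
    then have uv: "u \<in> {a, b, c, d, e}" "v \<in> {a, b, c, d, e}" unfolding V .
    have "{u, v} \<in> edges G \<longleftrightarrow> u \<in> nbr v" by (simp add: nbr_def)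
    also have "\<dots> \<longleftrightarrow> {\<phi> u, \<phi> v} \<in> edges (cycle_graph 5)"
      unfolding adj_cycle_graph using uv
      by (elim insertE emptyE) (use d d' in \<open>simp_all add: n val\<close>)
    finally show "{u, v} \<in> edges G \<longleftrightarrow> {\<phi> u, \<phi> v} \<in> edges (cycle_graph 5)" .
  qed (rule edges_cycle_graph)
qed

text \<open>Applied with an edgeless \<open>H\<close> and with the complete graph on two vertices.
  The bijection \<open>f\<close> is chosen inside the proof, hence \<open>adjA\<close> speaks of all
  bijections.\<close>

lemma iso_graph_join:
  assumes G: "is_graph G" and V: "\<Union>(edges G) = A \<union> B" "A \<inter> B = {}"
    and A: "card A = card (verts H)" "finite (verts H)" and B: "card B = m"
    and H: "\<And>e. e \<in> edges H \<Longrightarrow> \<exists>x\<in>verts H. \<exists>y\<in>verts H. e = {x, y}"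
    and adjA: "\<And>f u v. bij_betw f A (verts H) \<Longrightarrow> u \<in> A \<Longrightarrow> v \<in> A \<Longrightarrow>
      {u, v} \<in> edges G \<longleftrightarrow> {f u, f v} \<in> edges H"
    and adjB: "\<And>u v. u \<in> B \<Longrightarrow> v \<in> B \<Longrightarrow> {u, v} \<notin> edges G"
    and adjAB: "\<And>u v. u \<in> A \<Longrightarrow> v \<in> B \<Longrightarrow> {u, v} \<in> edges G"
  shows "graph_iso (remove_isolated G) (graph_join H (edgeless_graph m))"
proof -
  interpret edge_set "edges G" using edge_set_graph[OF G] .
  have fin: "finite A" "finite B" using finite_V unfolding V by auto
  obtain f where f: "bij_betw f A (verts H)"
    using finite_same_card_bij[OF fin(1) A(2,1)] by blast
  obtain g where g: "bij_betw g B {..<m}"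
    using finite_same_card_bij[OF fin(2), of "{..<m}"] B by auto
  define \<phi> where "\<phi> v = (if v \<in> A then Inl (f v) else Inr (g v))" for v
  have \<phi>: "\<phi> v = Inl (f v)" if "v \<in> A" for v using that by (simp add: \<phi>_def)
  have \<phi>': "\<phi> v = Inr (g v)" if "v \<in> B" for v using that V(2) by (auto simp: \<phi>_def)
  show ?thesis
  proof (rule graph_isoI[OF G])
    have "inj_on \<phi> (A \<union> B)"
    proof (rule inj_onI)
      fix u v assume uv: "u \<in> A \<union> B" "v \<in> A \<union> B" "\<phi> u = \<phi> v"
      then have "u \<in> A \<longleftrightarrow> v \<in> A" by (auto simp: \<phi>_def split: if_splits)
      with uv show "u = v"
        using inj_onD[OF bij_betw_imp_inj_on[OF f]] inj_onD[OF bij_betw_imp_inj_on[OF g]]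
        by (cases "u \<in> A") (auto simp: \<phi>_def)
    qed
    moreover have "\<phi> ` A = Inl ` verts H" "\<phi> ` B = Inr ` {..<m}"
    proof -
      have "\<phi> ` A = Inl ` f ` A" "\<phi> ` B = Inr ` g ` B"
        unfolding image_image by (rule image_cong; simp add: \<phi> \<phi>')+
      then show "\<phi> ` A = Inl ` verts H" "\<phi> ` B = Inr ` {..<m}"
        using f g by (simp_all add: bij_betw_def)
    qed
    then have "\<phi> ` (A \<union> B) = verts H <+> {..<m}" by (simp add: image_Un Plus_def)
    ultimately show "bij_betw \<phi> V (verts (graph_join H (edgeless_graph m)))"
      unfolding V by (simp add: bij_betw_def verts_simps)
    fix u v assume "u \<in> V" "v \<in> V"
    then consider "u \<in> A" "v \<in> A" | "u \<in> A" "v \<in> B" | "u \<in> B" "v \<in> A" | "u \<in> B" "v \<in> B"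
      unfolding V by blast
    then show "{u, v} \<in> edges G \<longleftrightarrow> {\<phi> u, \<phi> v} \<in> edges (graph_join H (edgeless_graph m))"
    proof cases
      case 1
      then show ?thesis by (simp add: \<phi> adj_graph_join adjA[OF f])
    next
      case 2
      then show ?thesis using adjAB[OF 2] bij_betwE[OF f] bij_betwE[OF g]
        by (simp add: \<phi> \<phi>' adj_graph_join verts_simps)
    next
      case 3
      then show ?thesis using adjAB[OF 3(2,1)] bij_betwE[OF f] bij_betwE[OF g]
        by (simp add: \<phi> \<phi>' adj_graph_join verts_simps insert_commute)
    next
      case 4
      then show ?thesis using adjB[OF 4] by (simp add: \<phi>' adj_graph_join edgeless_graph_def)
    qed
  qed (rule edges_graph_join[OF H])
qed

text \<open>By \<open>multi\<close> the graph is complete multipartite with the twin classes as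
  parts; the cases depend on their sizes and number.\<close>

lemma iso_multipartite:
  assumes G: "is_graph G" and ij: "{i, j} \<in> edges G"
    and multi: "\<And>u v. u \<in> \<Union>(edges G) \<Longrightarrow> v \<in> \<Union>(edges G) \<Longrightarrow>
      u \<in> edge_set.nbr (edges G) v \<longleftrightarrow> edge_set.nbr (edges G) u \<noteq> edge_set.nbr (edges G) v"
    and le: "\<And>k l. k \<in> \<Union>(edges G) \<Longrightarrow> l \<in> \<Union>(edges G) \<Longrightarrow> k \<noteq> l \<Longrightarrow>
      merge (edge_parity (edges G)) k l \<sqsubseteq> merge (edge_parity (edges G)) i j"
  shows "(\<exists>m\<ge>2. graph_iso (remove_isolated G) (graph_join (complete_graph 2) (edgeless_graph m)))
    \<or> (\<exists>n\<ge>2. graph_iso (remove_isolated G) (complete_graph n))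
    \<or> (\<exists>n m. 1 \<le> n \<and> n < m \<and>
          graph_iso (remove_isolated G) (graph_join (edgeless_graph n) (edgeless_graph m)))
    \<or> (\<exists>r n. 2 \<le> r \<and> 2 \<le> n \<and>
          graph_iso (remove_isolated G) (join_copies r (edgeless_graph n)))"
    (is "?K2 \<or> ?K \<or> ?bip \<or> ?multi")
proof -
  interpret edge_set "edges G" using edge_set_graph[OF G] .
  define part where "part v = {u \<in> V. nbr u = nbr v}" for v
  note Union_iff [simp del]
  have edge_iff: "{u, v} \<in> edges G \<longleftrightarrow> nbr u \<noteq> nbr v" if "u \<in> V" "v \<in> V" for u v
    using multi[OF that] by (simp add: nbr_def)
  have i: "i \<in> V" "j \<in> V" "i \<in> nbr j" using ij by (auto simp: nbr_def)
  have self: "v \<in> part v" if "v \<in> V" for v using that by (simp add: part_def)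
  have fin: "finite (part v)" for v using finite_V by (rule finite_subset[rotated]) (auto simp: part_def)
  show ?thesis
  proof (cases "\<forall>u\<in>V. \<forall>v\<in>V. card (part u) = card (part v)")
    case True
    define k where "k = card (part i)"
    have "k > 0" using self[OF i(1)] fin by (auto simp: k_def card_gt_0_iff)
    obtain \<phi> where \<phi>: "bij_betw \<phi> V ({..<card (nbr ` V)} \<times> {..<k})"
      and fst: "\<And>u v. u \<in> V \<Longrightarrow> v \<in> V \<Longrightarrow> fst (\<phi> u) = fst (\<phi> v) \<longleftrightarrow> nbr u = nbr v"
      using class_coordinates[OF finite_V, of nbr k] True i(1) unfolding part_def k_def by blast
    have r: "2 \<le> card (nbr ` V)"
      using i multi[OF i(1,2)] finite_V by (intro two_le_card[of _ "nbr i" "nbr j"]) blast+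
    show ?thesis
    proof (cases "k = 1")
      case k1: True
      have "bij_betw fst ({..<card (nbr ` V)} \<times> {..<k}) {..<card (nbr ` V)}"
        by (auto simp: k1 bij_betw_def inj_on_def image_iff)
      with \<phi> have b: "bij_betw (fst \<circ> \<phi>) V {..<card (nbr ` V)}" by (rule bij_betw_trans)
      have "graph_iso (remove_isolated G) (complete_graph (card (nbr ` V)))"
      proof (rule graph_isoI[OF G])
        show "bij_betw (fst \<circ> \<phi>) V (verts (complete_graph (card (nbr ` V))))"
          using b by (simp add: verts_simps)
        fix u v assume uv: "u \<in> V" "v \<in> V"
        then show "{u, v} \<in> edges G \<longleftrightarrow>
            {(fst \<circ> \<phi>) u, (fst \<circ> \<phi>) v} \<in> edges (complete_graph (card (nbr ` V)))"
          unfolding edge_iff[OF uv] adj_complete_graph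
          using fst[OF uv] bij_betw_apply[OF b uv(1)] bij_betw_apply[OF b uv(2)] by simp
      qed (rule edges_complete_graph)
      with r show ?thesis by blast
    next
      case False
      have "graph_iso (remove_isolated G) (join_copies (card (nbr ` V)) (edgeless_graph k))"
      proof (rule graph_isoI[OF G])
        show "bij_betw \<phi> V (verts (join_copies (card (nbr ` V)) (edgeless_graph k)))"
          using \<phi> by (simp add: verts_simps)
        fix u v assume uv: "u \<in> V" "v \<in> V"
        then show "{u, v} \<in> edges G \<longleftrightarrow>
            {\<phi> u, \<phi> v} \<in> edges (join_copies (card (nbr ` V)) (edgeless_graph k))"
          unfolding edge_iff[OF uv] adj_join_copies
          using fst[OF uv] bij_betw_apply[OF \<phi> uv(1)] bij_betw_apply[OF \<phi> uv(2)] by simp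
      qed (rule edges_join_copies)
      moreover have "2 \<le> k" using False \<open>k > 0\<close> by simp
      ultimately show ?thesis using r by blast
    qed
  next
    case False
    then obtain u v where uv: "u \<in> V" "v \<in> V" "card (part u) < card (part v)"
      by (metis linorder_neqE_nat)
    have disj: "part x \<inter> part y = {}" if "nbr x \<noteq> nbr y" for x y
      using that by (auto simp: part_def)
    have nuv: "nbr u \<noteq> nbr v" using uv(3) by (auto simp: part_def)
    show ?thesis
    proof (cases "V = part u \<union> part v")
      case True
      have "graph_iso (remove_isolated G)
          (graph_join (edgeless_graph (card (part u))) (edgeless_graph (card (part v))))"
      proof (rule iso_graph_join[OF G True disj[OF nuv]])
        fix x y
        show "{x, y} \<notin> edges G" if "x \<in> part v" "y \<in> part v"
          using that edge_iff[of x y] by (auto simp: part_def)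
        show "{x, y} \<in> edges G" if "x \<in> part u" "y \<in> part v"
          using that nuv edge_iff[of x y] by (auto simp: part_def)
        show "{x, y} \<in> edges G \<longleftrightarrow> {f x, f y} \<in> edges (edgeless_graph (card (part u)))"
          if "x \<in> part u" "y \<in> part u" for f
          using that edge_iff[of x y] by (auto simp: part_def edgeless_graph_def)
      qed (auto simp: edgeless_graph_def)
      moreover have "1 \<le> card (part u)" using self[OF uv(1)] fin by (auto simp: Suc_le_eq card_gt_0_iff)
      ultimately show ?thesis using uv(3) by blast
    next
      case False
      then obtain w where w: "w \<in> V" "nbr w \<noteq> nbr u" "nbr w \<noteq> nbr v"
        unfolding part_def by blast
      \<comment> \<open>A vertex adjacent to exactly one of \<open>x\<close> and \<open>w\<close>
        lies in the part of one of them; \<open>x\<close> and \<open>w\<close> themselves account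
        for the 2.\<close>
      have size: "card (sym_diff (nbr x) (nbr w) - {x, w}) = card (part x) + card (part w) - 2"
        if "x \<in> V" "nbr w \<noteq> nbr x" for x
      proof -
        have "sym_diff (nbr x) (nbr w) = part x \<union> part w"
        proof (rule set_eqI)
          fix y
          show "y \<in> sym_diff (nbr x) (nbr w) \<longleftrightarrow> y \<in> part x \<union> part w"
          proof (cases "y \<in> V")
            case True
            then show ?thesis using multi[OF True that(1)] multi[OF True w(1)] that(2)
              by (auto simp: part_def)
          next
            case False
            then show ?thesis using nbr_subset by (auto simp: part_def)
          qed
        qed
        moreover have "card (part x \<union> part w) = card (part x) + card (part w)"
          using disj that(2) fin by (intro card_Un_disjoint) auto
        moreover have "{x, w} \<subseteq> part x \<union> part w" "x \<noteq> w"
          using self that w(1) by blast+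
        ultimately show ?thesis by (simp add: card_Diff_subset)
      qed
      \<comment> \<open>Otherwise both edges share the invariant of the merge of
        \<open>i, j\<close>, so the parts of \<open>u\<close> and \<open>v\<close> have the same
        size.\<close>
      have "lossy u w \<or> lossy v w"
      proof (rule ccontr)
        assume nl: "\<not> (lossy u w \<or> lossy v w)"
        have adj: "u \<in> nbr w" "v \<in> nbr w" using multi[OF uv(1) w(1)] multi[OF uv(2) w(1)] w by auto
        then have ne: "u \<noteq> w" "v \<noteq> w" by auto
        have "card (sym_diff (nbr u) (nbr w) - {u, w}) = card (sym_diff (nbr v) (nbr w) - {v, w})"
          using card_sym_diff_not_lossy[OF i uv(1) w(1) adj(1) _ le[OF uv(1) w(1) ne(1)]]
            card_sym_diff_not_lossy[OF i uv(2) w(1) adj(2) _ le[OF uv(2) w(1) ne(2)]] nl by simp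
        then have "card (part u) + card (part w) - 2 = card (part v) + card (part w) - 2"
          using size uv w by simp
        moreover have "card (part u) > 0" "card (part w) > 0"
          using self uv w fin by (auto simp: card_gt_0_iff)
        ultimately show False using uv(3) by linarith
      qed
      \<comment> \<open>Renames \<open>u\<close> and \<open>v\<close> so that the lossy edge is
        \<open>{x, w}\<close>.\<close>
      then obtain x y where xy: "lossy x w" "x \<in> V" "y \<in> V" "nbr w \<noteq> nbr x" "nbr w \<noteq> nbr y"
        "nbr x \<noteq> nbr y" "card (part x) \<noteq> card (part y)"
        using uv w nuv by (metis less_irrefl)
      then obtain z where z: "nbr z = {x, w}" by (auto simp: lossy_def)
      then have zV: "z \<in> V" using in_V_iff by blast
      \<comment> \<open>A vertex other than \<open>x\<close> and \<open>w\<close> is not adjacent to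
        \<open>z\<close> and so is its twin. Hence \<open>x\<close> and \<open>w\<close> are
        singleton parts and all else is one part.\<close>
      have nz: "nbr q = nbr z" if "q \<in> V" "q \<noteq> x" "q \<noteq> w" for q
        using multi[OF that(1) zV] that z by auto
      have zx: "nbr z \<noteq> nbr x" "nbr z \<noteq> nbr w"
      proof -
        have "x \<in> nbr z" "w \<in> nbr z" using z by simp_all
        then show "nbr z \<noteq> nbr x" "nbr z \<noteq> nbr w"
          using not_nbr_self[of x] not_nbr_self[of w] by blast+
      qed
      have "x \<noteq> w" "y \<noteq> x" "y \<noteq> w" using xy by auto
      have ny: "nbr y = nbr z" using nz xy(3) \<open>y \<noteq> x\<close> \<open>y \<noteq> w\<close> .
      have px: "part x = {x}"
        using nz zx xy self[OF xy(2)] by (auto simp: part_def)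
      have V2: "V = {x, w} \<union> part y"
        using nz ny xy w(1) by (auto simp: part_def)
      have disj2: "{x, w} \<inter> part y = {}" using xy by (auto simp: part_def)
      have "graph_iso (remove_isolated G) (graph_join (complete_graph 2) (edgeless_graph (card (part y))))"
      proof (rule iso_graph_join[OF G V2 disj2])
        fix p q
        show "{p, q} \<notin> edges G" if "p \<in> part y" "q \<in> part y"
          using that edge_iff[of p q] by (auto simp: part_def)
        show "{p, q} \<in> edges G" if "p \<in> {x, w}" "q \<in> part y"
          using that xy w edge_iff[of p q] by (auto simp: part_def)
        show "{p, q} \<in> edges G \<longleftrightarrow> {f p, f q} \<in> edges (complete_graph 2)"
          if "bij_betw f {x, w} (verts (complete_graph 2))" "p \<in> {x, w}" "q \<in> {x, w}" for f
        proof -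
          have "p \<in> V" "q \<in> V" using that(2,3) xy w by blast+
          moreover have "nbr p \<noteq> nbr q \<longleftrightarrow> p \<noteq> q" using that(2,3) xy(4) by auto
          moreover have "f p = f q \<longleftrightarrow> p = q" "f p < 2" "f q < 2"
            using that bij_betwE[OF that(1)]
            by (auto simp: bij_betw_def inj_on_eq_iff verts_simps)
          ultimately show ?thesis by (simp add: edge_iff adj_complete_graph)
        qed
      qed (use \<open>x \<noteq> w\<close> edges_complete_graph in \<open>auto simp: verts_simps\<close>)
      \<comment> \<open>The part of \<open>x\<close> is a singleton and that of \<open>y\<close> has
        a different size.\<close>
      moreover have "card (part y) \<noteq> 1" "card (part y) > 0"
        using xy(7) px self[OF xy(3)] fin by (auto simp: card_gt_0_iff)
      then have "2 \<le> card (part y)" by linarith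
      ultimately show ?thesis by blast
    qed
  qed
qed

theorem theorem22:
  fixes G :: "'a graph"
  assumes "is_graph G"
  shows "join_irreducible G \<longleftrightarrow>
      (\<exists>n\<ge>2. graph_iso (remove_isolated G) (disjoint_copies n (complete_graph 3)))
    \<or> graph_iso (remove_isolated G) (cycle_graph 5)
    \<or> (\<exists>m\<ge>2. graph_iso (remove_isolated G) (graph_join (complete_graph 2) (edgeless_graph m)))
    \<or> (\<exists>n\<ge>2. graph_iso (remove_isolated G) (complete_graph n))
    \<or> (\<exists>n m. 1 \<le> n \<and> n < m \<and>
          graph_iso (remove_isolated G) (graph_join (edgeless_graph n) (edgeless_graph m)))
    \<or> (\<exists>r n. 2 \<le> r \<and> 2 \<le> n \<and>
          graph_iso (remove_isolated G) (join_copies r (edgeless_graph n)))"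
    (is "_ \<longleftrightarrow> ?triangles \<or> ?cycle \<or> ?rest")
proof
  interpret edge_set "edges G" using edge_set_graph[OF assms] .
  assume "join_irreducible G"
  then have "greatest_merge par"
    using join_irreducible_iff_greatest_merge(3)[OF assms graph_iso_refl]
    by (simp add: remove_isolated_def)
  then show "?triangles \<or> ?cycle \<or> ?rest"
  proof (cases rule: greatest_mergeD)
    case nonedge
    then show ?thesis using iso_triangles[OF assms] by blast
  next
    case (edge i j)
    show ?thesis
    \<comment> \<open>If non-adjacent vertices are always twins, the graph is complete
      multipartite.\<close>
    proof (cases "\<exists>k\<in>V. \<exists>l\<in>V. k \<notin> nbr l \<and> nbr k \<noteq> nbr l")
      case True
      then obtain k l where kl: "k \<in> V" "l \<in> V" "k \<notin> nbr l" "nbr k \<noteq> nbr l" by blast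
      have ?cycle
        by (rule five_cycle[OF edge(2) kl]) (assumption | rule iso_cycle[OF assms])+
      then show ?thesis by blast
    next
      case False
      have multi: "u \<in> nbr v \<longleftrightarrow> nbr u \<noteq> nbr v" if "u \<in> V" "v \<in> V" for u v
        using False that not_nbr_self by blast
      have "{i, j} \<in> edges G" using edge(1) by (simp add: nbr_def)
      then have ?rest by (rule iso_multipartite[OF assms]) (rule multi edge(3); assumption)+
      then show ?thesis by blast
    qed
  qed
next
  note iff = join_irreducible_iff_greatest_merge[OF assms]
  assume "?triangles \<or> ?cycle \<or> ?rest"
  then show "join_irreducible G"
  proof (elim disjE exE conjE)
    fix n assume "2 \<le> n" and iso: "graph_iso (remove_isolated G) (disjoint_copies n (complete_graph 3))"
    then show ?thesis using greatest_merge_triangles iff[OF iso] by blast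
  next
    assume iso: "graph_iso (remove_isolated G) (cycle_graph 5)"
    then show ?thesis using greatest_merge_cycle_graph iff[OF iso] by blast
  next
    fix m assume "2 \<le> m"
      and iso: "graph_iso (remove_isolated G) (graph_join (complete_graph 2) (edgeless_graph m))"
    then show ?thesis using greatest_merge_join_complete_2[of m] iff[OF iso] by simp
  next
    fix n assume "2 \<le> n" and iso: "graph_iso (remove_isolated G) (complete_graph n)"
    then show ?thesis using greatest_merge_complete_graph iff[OF iso] by blast
  next
    fix n m assume "1 \<le> n" "n < m"
      and iso: "graph_iso (remove_isolated G) (graph_join (edgeless_graph n) (edgeless_graph m))"
    then show ?thesis using greatest_merge_bipartite[of n m] iff[OF iso] by simp
  next
    fix r n assume "2 \<le> r" "2 \<le> n"
      and iso: "graph_iso (remove_isolated G) (join_copies r (edgeless_graph n))"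
    then show ?thesis using greatest_merge_join_copies[of r n] iff[OF iso] by simp
  qed
qed

end
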